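(* Let $p\equiv 1 \pmod 4$ be prime and let $T$ be the matrix with rows and columns indexed by $\mathbb{F}_p$ with entries $$T_{ij} = \sum_{x\in\mathbb{F}_p}\chi\big((ix-j)(ix-(j+1))((i+1)x-j)((i+1)x-(j+1))\big).$$ Then $\|T\| = O(p^{5/4})$ as $p\to\infty$.
   Context: $\chi$ denotes the Legendre symbol of $\mathbb{F}_p$ ($\chi(0)=0$, $\chi(x)=1$ for nonzero squares, $-1$ for non-squares). $\|\cdot\|$ is the operator norm. *)

theory Defs
  imports "HOL-Analysis.Analysis" "HOL-Number_Theory.Number_Theory" "HOL-Library.Landau_Symbols"
begin

text \<open>
  Real matrices with rows and columns indexed by a finite set \<open>I\<close> are functions of two
  arguments, of which only the values on \<open>I \<times> I\<close> matter. The operator norm is taken with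
  respect to the Euclidean norm, in the same form as \<^const>\<open>onorm\<close>; \<^const>\<open>onorm\<close>
  itself is not used because the dimension has to vary inside a proposition. As there, the vector
  \<open>0\<close> contributes \<open>0 / 0 = 0\<close>.
\<close>

definition mat_opnorm :: "'a set \<Rightarrow> ('a \<Rightarrow> 'a \<Rightarrow> real) \<Rightarrow> real" where
  "mat_opnorm I A = (SUP v. L2_set (\<lambda>i. \<Sum>j\<in>I. A i j * v j) I / L2_set v I)"

lemma mat_opnorm_bdd_above:
  "bdd_above (range (\<lambda>v. L2_set (\<lambda>i. \<Sum>j\<in>I. A i j * v j) I / L2_set v I))"
proof (rule bdd_aboveI2)
  fix v :: "'a \<Rightarrow> real"
  have "\<bar>\<Sum>j\<in>I. A i j * v j\<bar> \<le> L2_set (A i) I * L2_set v I" for i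
    using sum_abs[of "\<lambda>j. A i j * v j" I] L2_set_mult_ineq[of "A i" v I]
    by (simp add: abs_mult)
  then have "(\<Sum>i\<in>I. \<bar>\<Sum>j\<in>I. A i j * v j\<bar>) \<le> (\<Sum>i\<in>I. L2_set (A i) I * L2_set v I)"
    by (intro sum_mono)
  then have "L2_set (\<lambda>i. \<Sum>j\<in>I. A i j * v j) I \<le> (\<Sum>i\<in>I. L2_set (A i) I) * L2_set v I"
    using L2_set_le_sum_abs[of "\<lambda>i. \<Sum>j\<in>I. A i j * v j" I]
    by (simp add: sum_distrib_right)
  then show "L2_set (\<lambda>i. \<Sum>j\<in>I. A i j * v j) I / L2_set v I \<le> (\<Sum>i\<in>I. L2_set (A i) I)"
    by (cases "L2_set v I = 0") (auto simp: divide_le_eq less_le intro!: sum_nonneg)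
qed

text \<open>
  The elements of the prime field are represented by the integers \<open>0, \<dots>, p - 1\<close>. No reduction
  modulo \<open>p\<close> is needed, since \<^term>\<open>Legendre a (int p)\<close> depends only on the residue class of
  \<open>a\<close>.
\<close>

definition T_entry :: "nat \<Rightarrow> int \<Rightarrow> int \<Rightarrow> int" where
  "T_entry p i j =
     (\<Sum>x\<in>{0..<int p}. Legendre
        ((i * x - j) * (i * x - (j + 1)) * ((i + 1) * x - j) * ((i + 1) * x - (j + 1))) (int p))"

end

theory Submission
  imports Defs
begin

text \<open>
  Put \<open>g a = \<chi>(a (a - 1))\<close> with Fourier transform \<open>h\<close>. The Fourier transform of the \<open>i\<close>-th row of
  \<open>T\<close> is \<open>k \<mapsto> h(i k) h(-(i + 1) k)\<close>, so the Gram matrix \<open>T T\<^sup>t\<close> consists of sums over \<open>k\<close> of four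
  values of \<open>h\<close> at multiples \<open>\<alpha>k, \<beta>k, \<gamma>k, \<delta>k\<close> with \<open>\<alpha> + \<beta> + \<gamma> + \<delta> = 0\<close>. Averaging over this whole
  hyperplane and applying Parseval bounds the Frobenius norm of \<open>T T\<^sup>t\<close> by the fourth moment of the
  elliptic sums \<open>E(k, k', t) = \<Sum> g(a) g(a')\<close> over \<open>k a - k' a' + t = 0\<close>; what is needed is
  \<open>\<Sum> E\<^sup>4 = O(p\<^sup>5)\<close>.

  Weil's bound would give this, but the fourth moment is elementary. Each \<open>E\<close> is, up to \<open>O(1)\<close>, a sum
  \<open>\<Sum> \<chi>(x q(x))\<close> with \<open>q = a x\<^sup>2 + b x + c\<close>. Writing a pair of variables as \<open>(x, r x)\<close> and fibring over
  \<open>t = q(x) / q(r x)\<close>, its square becomes \<open>G(b\<^sup>2 - 4 a c, 4 a c) + O(p)\<close>, where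
  \<open>G(A, B) = \<Sum> \<chi>(A U(s) + B U(r))\<close> over \<open>r, s \<noteq> 0\<close> and \<open>U(s) = (s - 1)\<^sup>2 / s\<close> (a finite field
  form of Clausen's formula). Since \<open>G\<close> is a sum of characters of linear forms in \<open>A, B\<close>, its second
  moment is an orthogonality computation, and the parameters \<open>(A, B)\<close> are hit a bounded number of
  times.
\<close>

section \<open>Operator norm and Gram matrix\<close>

text \<open>The zero vector contributes 0 / 0 = 0 to the supremum.\<close>

lemma mat_opnorm_nonneg: "0 \<le> mat_opnorm I A"
proof -
  have "L2_set (\<lambda>i. \<Sum>j\<in>I. A i j * 0) I / L2_set (\<lambda>_. 0) I \<le> mat_opnorm I A"
    unfolding mat_opnorm_def by (rule cSUP_upper[OF UNIV_I mat_opnorm_bdd_above])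
  then show ?thesis by (simp add: L2_set_def)
qed

text \<open>With \<open>w\<close> = A v and \<open>y\<close> = A^t w, Cauchy-Schwarz gives |w|^2 =
  (y, v) \<le> |y| |v|. Moreover |y|^2 is the quadratic form of the Gram matrix \<open>S\<close> at
  \<open>w\<close>, so it is at most the Frobenius norm of \<open>S\<close> times |w|^2.\<close>

lemma mat_opnorm_le_gram:
  fixes A :: "'a \<Rightarrow> 'a \<Rightarrow> real"
  assumes K: "0 \<le> K" and gram: "(\<Sum>i\<in>I. \<Sum>i'\<in>I. (\<Sum>j\<in>I. A i j * A i' j)\<^sup>2) \<le> K ^ 4"
  shows "mat_opnorm I A \<le> K"
  unfolding mat_opnorm_def
proof (rule cSUP_least)
  fix v :: "'a \<Rightarrow> real"
  define w where "w i = (\<Sum>j\<in>I. A i j * v j)" for i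
  define y where "y j = (\<Sum>i\<in>I. A i j * w i)" for j
  define S where "S i i' = (\<Sum>j\<in>I. A i j * A i' j)" for i i'
  have sq: "(L2_set f I)\<^sup>2 = (\<Sum>i\<in>I. (f i)\<^sup>2)" for f :: "'a \<Rightarrow> real"
    by (simp add: L2_set_def sum_nonneg)
  have "(L2_set w I)\<^sup>2 = (\<Sum>i\<in>I. \<Sum>j\<in>I. w i * (A i j * v j))"
    unfolding sq by (simp add: power2_eq_square) (simp add: w_def sum_distrib_left)
  also have "\<dots> = (\<Sum>j\<in>I. y j * v j)"
    unfolding y_def sum_distrib_right by (subst sum.swap) (simp add: mult_ac)
  also have "\<dots> \<le> (\<Sum>j\<in>I. \<bar>y j\<bar> * \<bar>v j\<bar>)"
    by (intro sum_mono) (simp flip: abs_mult)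
  also have "\<dots> \<le> L2_set y I * L2_set v I" by (rule L2_set_mult_ineq)
  finally have w: "(L2_set w I)\<^sup>2 \<le> L2_set y I * L2_set v I" .
  have "(L2_set y I)\<^sup>2 = (\<Sum>j\<in>I. \<Sum>i\<in>I. \<Sum>i'\<in>I. (A i j * w i) * (A i' j * w i'))"
    unfolding sq by (simp add: y_def power2_eq_square sum_product)
  also have "\<dots> = (\<Sum>i\<in>I. \<Sum>j\<in>I. \<Sum>i'\<in>I. (A i j * w i) * (A i' j * w i'))"
    by (rule sum.swap)
  also have "\<dots> = (\<Sum>i\<in>I. \<Sum>i'\<in>I. \<Sum>j\<in>I. (A i j * w i) * (A i' j * w i'))"
    by (intro sum.cong refl sum.swap)
  also have "\<dots> = (\<Sum>i\<in>I. \<Sum>i'\<in>I. S i i' * (w i * w i'))"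
    unfolding S_def sum_distrib_right by (simp add: mult_ac)
  also have "\<dots> = (\<Sum>z\<in>I\<times>I. S (fst z) (snd z) * (w (fst z) * w (snd z)))"
    by (simp add: sum.cartesian_product')
  also have "\<dots> \<le> (\<Sum>z\<in>I\<times>I. \<bar>S (fst z) (snd z)\<bar> * \<bar>w (fst z) * w (snd z)\<bar>)"
    by (intro sum_mono) (simp flip: abs_mult)
  also have "\<dots> \<le> L2_set (\<lambda>z. S (fst z) (snd z)) (I\<times>I) * L2_set (\<lambda>z. w (fst z) * w (snd z)) (I\<times>I)"
    by (rule L2_set_mult_ineq)
  \<comment> \<open>The Frobenius norm of the rank one matrix w w^t is |w|^2.\<close>
  also have "L2_set (\<lambda>z. w (fst z) * w (snd z)) (I\<times>I) = (L2_set w I)\<^sup>2"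
  proof -
    have "(\<Sum>z\<in>I\<times>I. (w (fst z) * w (snd z))\<^sup>2) = ((L2_set w I)\<^sup>2)\<^sup>2"
      unfolding sq by (simp add: sum.cartesian_product' power_mult_distrib power2_eq_square[of "sum _ _"] sum_product)
    then show ?thesis unfolding L2_set_def[of _ "I \<times> I"]
      by (simp only: real_sqrt_abs abs_power2)
  qed
  also have "L2_set (\<lambda>z. S (fst z) (snd z)) (I\<times>I) \<le> K\<^sup>2"
  proof -
    have "(\<Sum>z\<in>I\<times>I. (S (fst z) (snd z))\<^sup>2) \<le> (K\<^sup>2)\<^sup>2"
      using gram by (simp add: sum.cartesian_product' S_def)
    then show ?thesis unfolding L2_set_def by (intro real_le_lsqrt) auto
  qed
  finally have "(L2_set y I)\<^sup>2 \<le> (K * L2_set w I)\<^sup>2"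
    by (simp add: power_mult_distrib mult_right_mono)
  then have "L2_set y I \<le> K * L2_set w I"
    by (rule power2_le_imp_le) (use K in simp)
  then have "L2_set w I * L2_set w I \<le> (K * L2_set v I) * L2_set w I"
    using w mult_right_mono[of "L2_set y I" "K * L2_set w I" "L2_set v I"]
    by (simp add: power2_eq_square mult_ac)
  then have "L2_set w I \<le> K * L2_set v I"
    using K by (cases "L2_set w I = 0") (auto simp: less_le mult_le_cancel_right)
  then show "L2_set (\<lambda>i. \<Sum>j\<in>I. A i j * v j) I / L2_set v I \<le> K"
    using K unfolding w_def[symmetric]
    by (cases "L2_set v I = 0") (auto simp: divide_le_eq less_le)
qed simp

section \<open>Character sums over the prime field\<close>

locale odd_prime =
  fixes p :: nat
  assumes prime_p: "prime p" and p_gt_2: "2 < p"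
begin

abbreviation F :: "int set" where "F \<equiv> {0..<int p}"

definition chi :: "int \<Rightarrow> real" where "chi x = real_of_int (Legendre x (int p))"

text \<open>The inverse modulo \<open>p\<close> by Fermat; \<open>rinv 0 = 0\<close>.\<close>
definition rinv :: "int \<Rightarrow> int" where "rinv x = x ^ (p - 2)"

definition ind :: "int \<Rightarrow> real" where "ind x = of_bool (int p dvd x)"

lemma prime_int_p: "prime (int p)"
  using prime_p by simp

lemma dvd_mult_iff: "int p dvd x * y \<longleftrightarrow> int p dvd x \<or> int p dvd y"
  using prime_int_p by (rule prime_dvd_mult_iff)

lemma dvd_pow2_iff: "int p dvd x\<^sup>2 \<longleftrightarrow> int p dvd x"
  by (simp add: power2_eq_square dvd_mult_iff)

lemma not_dvd_2: "\<not> int p dvd 2"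
  using p_gt_2 zdvd_imp_le[of "int p" 2] by auto

lemma not_dvd_4: "\<not> int p dvd 4"
  using not_dvd_2 dvd_mult_iff[of 2 2] by simp

lemma not_dvd_1: "\<not> int p dvd 1"
  using p_gt_2 by auto

lemma dvd_cong: "[x = y] (mod int p) \<Longrightarrow> int p dvd x \<longleftrightarrow> int p dvd y"
  by (rule cong_dvd_iff)

lemma dvd_F_iff: "x \<in> F \<Longrightarrow> int p dvd x \<longleftrightarrow> x = 0"
  using zdvd_imp_le[of "int p" x] by force

lemma card_F: "card F = p"
  by simp

section \<open>The Legendre symbol and inverses modulo p\<close>

lemma chi_cong: "[x = y] (mod int p) \<Longrightarrow> chi x = chi y"
  by (simp add: chi_def Legendre_def QuadRes_def cong_def)

lemma ind_cong: "[x = y] (mod int p) \<Longrightarrow> ind x = ind y"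
  unfolding ind_def using dvd_cong by simp

lemma cong_mod_self: "[x mod int p = x] (mod int p)"
  by simp

lemma cong_uminus: "[x = y] (mod int p) \<Longrightarrow> [- x = - y] (mod int p)"
  by (simp add: cong_minus_minus_iff)

lemma chi_eq_0_iff: "chi x = 0 \<longleftrightarrow> int p dvd x"
  by (auto simp: chi_def Legendre_def cong_0_iff)

lemma chi_0: "chi 0 = 0"
  by (simp add: chi_eq_0_iff)

lemma chi_cases: "chi x = 0 \<or> chi x = 1 \<or> chi x = -1"
  by (auto simp: chi_def Legendre_def)

lemma abs_chi_le: "\<bar>chi x\<bar> \<le> 1"
  using chi_cases[of x] by auto

text \<open>By Euler's criterion the two sides are congruent modulo p. They lie in {-1, 0, 1}, so
  they differ by at most 2 < p and are equal.\<close>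

lemma chi_mult: "chi (x * y) = chi x * chi y"
proof -
  have e: "[Legendre a (int p) = a ^ ((p - 1) div 2)] (mod int p)" for a
    using euler_criterion[OF prime_p p_gt_2, of a] by (simp add: zdiv_int of_nat_diff)
  have "[Legendre (x * y) (int p) = Legendre x (int p) * Legendre y (int p)] (mod int p)"
    using cong_trans[OF e[of "x * y"]] cong_sym[OF cong_mult[OF e[of x] e[of y]]]
    by (simp add: power_mult_distrib)
  then have d: "int p dvd Legendre (x * y) (int p) - Legendre x (int p) * Legendre y (int p)"
    by (simp add: cong_iff_dvd_diff)
  have v: "Legendre a (int p) \<in> {0, 1, -1}" for a by (auto simp: Legendre_def)
  have "\<bar>Legendre (x * y) (int p) - Legendre x (int p) * Legendre y (int p)\<bar> \<le> 2"
    using v[of x] v[of y] v[of "x * y"] by auto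
  with d p_gt_2 have "Legendre (x * y) (int p) - Legendre x (int p) * Legendre y (int p) = 0"
    using dvd_imp_le_int[of "Legendre (x * y) (int p) - Legendre x (int p) * Legendre y (int p)" "int p"]
    by force
  then show ?thesis by (simp add: chi_def flip: of_int_mult)
qed

lemma chi_1: "chi 1 = 1"
proof -
  have "QuadRes (int p) 1" unfolding QuadRes_def by (rule exI[of _ 1]) simp
  then show ?thesis using not_dvd_1 by (auto simp: chi_def Legendre_def cong_0_iff)
qed

lemma chi_sq: "chi x * chi x = 1 - ind x"
  using chi_cases[of x] chi_eq_0_iff[of x] by (auto simp: ind_def)

lemma chi_square: "chi (x\<^sup>2) = 1 - ind x"
  by (simp add: power2_eq_square chi_mult chi_sq)

lemma rinv: "\<not> int p dvd x \<Longrightarrow> [x * rinv x = 1] (mod int p)"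
proof -
  assume x: "\<not> int p dvd x"
  \<comment> \<open>Fermat's little theorem speaks of natural numbers, so it is applied to the
    residue of \<open>x\<close>.\<close>
  have "int (nat (x mod int p)) = x mod int p" using p_gt_2 by simp
  with x have nd: "\<not> p dvd nat (x mod int p)"
    by (metis dvd_mod_iff dvd_refl int_dvd_int_iff)
  have "[nat (x mod int p) ^ (p - 1) = 1] (mod p)"
    by (rule fermat_theorem[OF prime_p nd])
  then have "[int (nat (x mod int p) ^ (p - 1)) = int 1] (mod int p)"
    by (simp only: cong_int_iff)
  then have "[(x mod int p) ^ (p - 1) = 1] (mod int p)"
    using p_gt_2 by simp
  then have "[x ^ (p - 1) = 1] (mod int p)"
    by (simp add: cong_def mod_simps)
  moreover have "x * rinv x = x ^ (p - 1)"
    unfolding rinv_def using p_gt_2 by (simp add: Suc_diff_Suc numeral_2_eq_2 flip: power_Suc)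
  ultimately show ?thesis by simp
qed

lemma rinv_dvd_iff: "int p dvd rinv x \<longleftrightarrow> int p dvd x"
  unfolding rinv_def using p_gt_2 prime_int_p by (simp add: prime_dvd_power_iff)

lemma rinv_cong: "[x = y] (mod int p) \<Longrightarrow> [rinv x = rinv y] (mod int p)"
  unfolding rinv_def by (rule cong_pow)

lemma chi_rinv: "chi (rinv x) = chi x"
proof (cases "int p dvd x")
  case True then show ?thesis using chi_eq_0_iff rinv_dvd_iff by metis
next
  case False
  then have "chi x * chi (rinv x) = 1" using chi_cong[OF rinv] by (simp add: chi_1 chi_mult)
  then show ?thesis using chi_cases[of x] chi_cases[of "rinv x"] by auto
qed

text \<open>Used as introduction rules, these show that an expression in \<open>chi\<close>,
  \<open>ind\<close> and \<open>rinv\<close> is unchanged when a variable is reduced modulo p, which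
  is the side condition of each substitution in a sum over \<open>F\<close>.\<close>

lemmas periodic_intros = chi_cong ind_cong cong_refl cong_mod_self cong_add cong_diff cong_mult cong_pow
  cong_uminus rinv_cong

section \<open>Substitutions in sums over residues\<close>

lemma cong_in_F_eq: "x \<in> F \<Longrightarrow> y \<in> F \<Longrightarrow> [x = y] (mod int p) \<Longrightarrow> x = y"
  by (simp add: cong_def)

lemma mod_in_F: "x mod int p \<in> F"
  using p_gt_2 by simp

text \<open>An injective self-map of a finite set permutes it. Residues are integers in
  \<open>F\<close>, so the map is \<open>h\<close> followed by reduction, which the periodic
  \<open>f\<close> does not see.\<close>

lemma sum_bij_mod:
  assumes per: "\<And>x. f (x mod int p) = f x"
    and inj: "\<And>x y. x \<in> A \<Longrightarrow> y \<in> A \<Longrightarrow> [h x = h y] (mod int p) \<Longrightarrow> x = y"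
    and sub: "\<And>x. x \<in> A \<Longrightarrow> h x mod int p \<in> A" and fin: "finite A"
  shows "(\<Sum>x\<in>A. f (h x)) = (\<Sum>x\<in>A. f x)"
proof -
  have i: "inj_on (\<lambda>x. h x mod int p) A"
    using inj by (auto simp: inj_on_def cong_def)
  then have "(\<lambda>x. h x mod int p) ` A = A"
    using sub fin by (intro endo_inj_surj) auto
  then have "(\<Sum>x\<in>A. f x) = (\<Sum>x\<in>(\<lambda>x. h x mod int p) ` A. f x)" by simp
  also have "\<dots> = (\<Sum>x\<in>A. f (h x))"
    by (subst sum.reindex[OF i]) (simp add: per)
  finally show ?thesis by simp
qed

lemma sum_affine:
  assumes per: "\<And>x. f (x mod int p) = f x" and a: "\<not> int p dvd a"
  shows "(\<Sum>x\<in>F. f (a * x + b)) = (\<Sum>x\<in>F. f x)"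
proof (rule sum_bij_mod[where f = f, OF per])
  fix x y assume xy: "x \<in> F" "y \<in> F" "[a * x + b = a * y + b] (mod int p)"
  then have "int p dvd a * (x - y)"
    by (simp add: cong_iff_dvd_diff algebra_simps)
  with a have "[x = y] (mod int p)" by (simp add: dvd_mult_iff cong_iff_dvd_diff)
  with xy show "x = y" using cong_in_F_eq by blast
qed (use p_gt_2 in auto)

lemma sum_rinv:
  assumes per: "\<And>x. f (x mod int p) = f x"
  shows "(\<Sum>x\<in>F - {0}. f (rinv x)) = (\<Sum>x\<in>F - {0}. f x)"
proof (rule sum_bij_mod[where f = f, OF per])
  fix x y assume xy: "x \<in> F - {0}" "y \<in> F - {0}" and c: "[rinv x = rinv y] (mod int p)"
  from xy have u: "\<not> int p dvd x" "\<not> int p dvd y" using dvd_F_iff by auto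
  \<comment> \<open>The product \<open>x * rinv y * y\<close> is congruent to \<open>x\<close> and,
    since the inverses agree, also to \<open>y\<close>.\<close>
  have "[x * rinv y * y = x * rinv x * y] (mod int p)"
    using c by (intro cong_mult cong_refl) (rule cong_sym)
  moreover have "[x * rinv x * y = 1 * y] (mod int p)"
    by (intro cong_mult cong_refl rinv u)
  moreover have "[x * (y * rinv y) = x * 1] (mod int p)"
    by (intro cong_mult cong_refl rinv u)
  ultimately have "[x = y] (mod int p)"
    by (metis (no_types, lifting) cong_sym cong_trans mult.assoc mult.commute mult_1_left)
  with xy show "x = y" using cong_in_F_eq by blast
next
  fix x assume x: "x \<in> F - {0}"
  then have "\<not> int p dvd x" using dvd_F_iff by auto
  then have "\<not> int p dvd rinv x" by (simp add: rinv_dvd_iff)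
  then show "rinv x mod int p \<in> F - {0}" using mod_in_F by (auto simp: dvd_eq_mod_eq_0)
qed simp

lemma sum_F_split: "(\<Sum>x\<in>F. f x) = f 0 + (\<Sum>x\<in>F - {0}. f x)"
  using p_gt_2 by (simp add: sum.remove)

text \<open>Shifting the variable by the root -b/a turns the indicator into
  \<open>ind (a * x)\<close>, which selects x = 0.\<close>

lemma sum_ind_times:
  assumes per: "\<And>x. f (x mod int p) = (f x :: real)" and a: "\<not> int p dvd a"
  shows "(\<Sum>x\<in>F. ind (a * x + b) * f x) = f (- b * rinv a)"
proof -
  have P: "ind (a * (x mod int p) + b) * f (x mod int p) = ind (a * x + b) * f x" for x
    unfolding per by (rule arg_cong[where f = "\<lambda>y. y * f x"]) ((rule periodic_intros)+)
  have "(\<Sum>x\<in>F. ind (a * x + b) * f x)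
      = (\<Sum>x\<in>F. ind (a * (1 * x + - b * rinv a) + b) * f (1 * x + - b * rinv a))"
    using sum_affine[of "\<lambda>x. ind (a * x + b) * f x" 1 "- b * rinv a", OF P not_dvd_1] by simp
  also have "\<dots> = (\<Sum>x\<in>F. if x = 0 then f (- b * rinv a) else 0)"
  proof (rule sum.cong[OF refl])
    fix x assume x: "x \<in> F"
    have "a * (1 * x + - b * rinv a) + b = a * x + - b * (a * rinv a) + b"
      by (simp add: algebra_simps)
    moreover have "[\<dots> = a * x + - b * 1 + b] (mod int p)"
      by (intro cong_add cong_mult cong_refl rinv a)
    ultimately have "ind (a * (1 * x + - b * rinv a) + b) = ind (a * x)"
      using ind_cong by simp
    then show "ind (a * (1 * x + - b * rinv a) + b) * f (1 * x + - b * rinv a)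
        = (if x = 0 then f (- b * rinv a) else 0)"
      using a dvd_F_iff[OF x] by (simp add: ind_def dvd_mult_iff)
  qed
  also have "\<dots> = f (- b * rinv a)" using p_gt_2 by simp
  finally show ?thesis .
qed

lemma sum_ind_affine:
  assumes "\<not> int p dvd a"
  shows "(\<Sum>x\<in>F. ind (a * x + b)) = 1"
  using sum_ind_times[of "\<lambda>_. 1" a b] assms by simp

section \<open>Solution counts and sums of chi over polynomials of degree at most two\<close>

lemma chi_per: "chi (x mod int p) = chi x"
  by (rule chi_cong) simp

text \<open>The number of square roots of \<open>d\<close> is 1, 2 or 0 according as
  \<open>d\<close> is zero, a nonzero square or a non-square.\<close>

lemma sum_ind_square:
  "(\<Sum>y\<in>F. ind (y\<^sup>2 - d)) = 1 + chi d"
proof -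
  consider "int p dvd d" | s where "\<not> int p dvd d" "[s\<^sup>2 = d] (mod int p)"
    | "\<not> int p dvd d" "\<not> QuadRes (int p) d"
    unfolding QuadRes_def by blast
  then show ?thesis
  proof cases
    case 1
    have "(\<Sum>y\<in>F. ind (y\<^sup>2 - d)) = (\<Sum>y\<in>F. ind (1 * y + 0))"
      using 1 by (intro sum.cong refl) (simp add: ind_def dvd_pow2_iff dvd_diff_left_iff)
    then show ?thesis using sum_ind_affine[OF not_dvd_1, of 0] 1 chi_eq_0_iff[of d] by simp
  next
    case (2 s)
    have s: "\<not> int p dvd s" using 2 dvd_cong dvd_pow2_iff by blast
    have "ind (y\<^sup>2 - d) = ind (1 * y + s) + ind (1 * y + (- s))" for y
    proof -
      have "ind (y\<^sup>2 - d) = ind ((y + s) * (y - s))"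
        using 2 by (intro ind_cong) (auto simp: cong_iff_dvd_diff algebra_simps power2_eq_square)
      moreover have "\<not> (int p dvd y + s \<and> int p dvd y - s)"
      proof
        assume "int p dvd y + s \<and> int p dvd y - s"
        then have "int p dvd (y + s) - (y - s)" using dvd_diff by blast
        then have "int p dvd 2 * s" by (simp add: algebra_simps)
        with s not_dvd_2 show False by (simp add: dvd_mult_iff)
      qed
      ultimately show ?thesis by (auto simp: ind_def dvd_mult_iff)
    qed
    then have "(\<Sum>y\<in>F. ind (y\<^sup>2 - d)) = 2"
      using sum_ind_affine[OF not_dvd_1, of s] sum_ind_affine[OF not_dvd_1, of "-s"]
      by (simp add: sum.distrib)
    moreover have "chi d = 1"
      using 2 unfolding chi_def Legendre_def QuadRes_def by (auto simp: cong_0_iff)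
    ultimately show ?thesis by simp
  next
    case 3
    have "ind (y\<^sup>2 - d) = 0" for y
      using 3 by (auto simp: ind_def QuadRes_def cong_iff_dvd_diff)
    moreover have "chi d = -1"
      using 3 unfolding chi_def Legendre_def by (auto simp: cong_0_iff)
    ultimately show ?thesis by simp
  qed
qed

text \<open>Completing the square: multiplication by the unit 4a reduces to counting square roots of
  the discriminant.\<close>

lemma sum_ind_quadratic:
  assumes a: "\<not> int p dvd a"
  shows "(\<Sum>x\<in>F. ind (a * x\<^sup>2 + b * x + c)) = 1 + chi (b\<^sup>2 - 4 * a * c)"
proof -
  have "ind (a * x\<^sup>2 + b * x + c) = ind ((2 * a * x + b)\<^sup>2 - (b\<^sup>2 - 4 * a * c))" for x
  proof -
    have "(2 * a * x + b)\<^sup>2 - (b\<^sup>2 - 4 * a * c) = 4 * a * (a * x\<^sup>2 + b * x + c)"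
      by (simp add: algebra_simps power2_eq_square)
    then show ?thesis using a not_dvd_4 by (simp add: ind_def dvd_mult_iff)
  qed
  then have "(\<Sum>x\<in>F. ind (a * x\<^sup>2 + b * x + c))
      = (\<Sum>x\<in>F. ind ((2 * a * x + b)\<^sup>2 - (b\<^sup>2 - 4 * a * c)))" by simp
  also have "\<dots> = (\<Sum>x\<in>F. ind (x\<^sup>2 - (b\<^sup>2 - 4 * a * c)))"
    using a not_dvd_2
    by (intro sum_affine[where f = "\<lambda>x. ind (x\<^sup>2 - (b\<^sup>2 - 4 * a * c))"])
       ((rule periodic_intros)+, simp add: dvd_mult_iff)
  finally show ?thesis by (simp add: sum_ind_square)
qed

text \<open>The pairs (x, y) with x^2 = y number p; counted by \<open>y\<close> instead, they number
  p plus the sum of \<open>chi\<close>.\<close>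

lemma sum_chi: "(\<Sum>x\<in>F. chi x) = 0"
proof -
  have "(\<Sum>y\<in>F. \<Sum>x\<in>F. ind (x\<^sup>2 - y)) = (\<Sum>x\<in>F. \<Sum>y\<in>F. ind (x\<^sup>2 - y))"
    by (rule sum.swap)
  also have "\<dots> = (\<Sum>x\<in>F. 1)"
    using sum_ind_affine[of "-1"] not_dvd_1 by (intro sum.cong refl) (simp add: algebra_simps)
  finally show ?thesis by (simp add: sum_ind_square sum.distrib)
qed

lemma sum_chi_affine:
  assumes "\<not> int p dvd a"
  shows "(\<Sum>x\<in>F. chi (a * x + b)) = 0"
  using sum_affine[of chi a b, OF chi_per assms] sum_chi by simp

text \<open>Group the \<open>x\<close> by the value \<open>z\<close> of the quadratic; each fibre is
  counted by its discriminant.\<close>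

lemma sum_comp_quadratic:
  assumes a: "\<not> int p dvd a" and per: "\<And>x. f (x mod int p) = (f x :: real)"
  shows "(\<Sum>x\<in>F. f (a * x\<^sup>2 + b * x + c)) = (\<Sum>z\<in>F. (1 + chi (b\<^sup>2 - 4 * a * (c - z))) * f z)"
proof -
  have "f w = (\<Sum>z\<in>F. ind ((-1) * z + w) * f z)" for w
  proof -
    \<comment> \<open>Needed because \<open>sum_ind_times\<close> expresses the root through
      \<open>rinv\<close>: an odd exponent gives \<open>rinv (-1) = -1\<close>.\<close>
    have "odd (p - 2)" using prime_odd_nat[OF prime_p p_gt_2] p_gt_2 by simp
    then have "rinv (-1) = -1" by (simp add: rinv_def)
    then show ?thesis
      using sum_ind_times[of f "-1" w, OF per] not_dvd_1 by simp
  qed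
  then have "(\<Sum>x\<in>F. f (a * x\<^sup>2 + b * x + c))
     = (\<Sum>x\<in>F. \<Sum>z\<in>F. ind ((-1) * z + (a * x\<^sup>2 + b * x + c)) * f z)"
    by (rule sum.cong[OF refl])
  also have "\<dots> = (\<Sum>z\<in>F. (\<Sum>x\<in>F. ind (a * x\<^sup>2 + b * x + (c - z))) * f z)"
    by (subst sum.swap) (simp add: sum_distrib_left algebra_simps)
  finally show ?thesis using sum_ind_quadratic[OF a] by simp
qed

text \<open>A quadratic takes each value at most twice.\<close>

lemma sum_comp_quadratic_le:
  assumes a: "\<not> int p dvd a" and per: "\<And>x. f (x mod int p) = (f x :: real)"
    and nn: "\<And>x. 0 \<le> f x"
  shows "(\<Sum>x\<in>F. f (a * x\<^sup>2 + b * x + c)) \<le> 2 * (\<Sum>z\<in>F. f z)"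
proof -
  have "1 + chi z \<le> 2" for z using abs_chi_le[of z] by linarith
  then have "(\<Sum>z\<in>F. (1 + chi (b\<^sup>2 - 4 * a * (c - z))) * f z) \<le> (\<Sum>z\<in>F. 2 * f z)"
    using nn by (intro sum_mono mult_right_mono) auto
  then show ?thesis using sum_comp_quadratic[where f = f, OF a per] by (simp add: sum_distrib_left)
qed

text \<open>Dividing by the square x^2 turns the summand into chi(1 + d/x). As \<open>x\<close> runs
  over the units, 1 + d/x takes every value except 1, so the full sum 0 loses chi(1) = 1.\<close>

lemma sum_chi_two_linear:
  assumes d: "\<not> int p dvd d"
  shows "(\<Sum>x\<in>F. chi (x * (x + d))) = -1"
proof -
  have "(\<Sum>x\<in>F. chi (x * (x + d))) = (\<Sum>x\<in>F - {0}. chi (x * (x + d)))"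
    by (subst sum_F_split) (simp add: chi_eq_0_iff)
  also have "\<dots> = (\<Sum>x\<in>F - {0}. chi (d * rinv x + 1))"
  proof (rule sum.cong[OF refl])
    fix x assume "x \<in> F - {0}"
    then have x: "\<not> int p dvd x" using dvd_F_iff by auto
    have "[x * rinv x + d * rinv x = 1 + d * rinv x] (mod int p)"
      by (intro cong_add cong_refl rinv x)
    then have "chi (rinv x * (x + d)) = chi (d * rinv x + 1)"
      using chi_cong by (simp add: algebra_simps)
    then show "chi (x * (x + d)) = chi (d * rinv x + 1)"
      by (simp add: chi_mult chi_rinv)
  qed
  also have "\<dots> = (\<Sum>x\<in>F - {0}. chi (d * x + 1))"
    by (rule sum_rinv[where f = "\<lambda>x. chi (d * x + 1)"])
       ((rule periodic_intros)+)
  also have "\<dots> = (\<Sum>x\<in>F. chi (d * x + 1)) - 1"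
    by (subst sum_F_split) (simp add: chi_1)
  finally show ?thesis by (simp add: sum_chi_affine[OF d])
qed

text \<open>Grouping by the value \<open>z\<close> leaves the sum of \<open>chi z\<close>, which is
  0, and a sum over a product of two linear forms in \<open>z\<close>. Rescaling \<open>z\<close> by
  4a brings the latter to the form z (z + d) with \<open>d\<close> the discriminant.\<close>

lemma sum_chi_quadratic:
  assumes a: "\<not> int p dvd a" and d: "\<not> int p dvd b\<^sup>2 - 4 * a * c"
  shows "(\<Sum>x\<in>F. chi (a * x\<^sup>2 + b * x + c)) = - chi a"
proof -
  have "(\<Sum>x\<in>F. chi (a * x\<^sup>2 + b * x + c))
      = (\<Sum>z\<in>F. (1 + chi (b\<^sup>2 - 4 * a * (c - z))) * chi z)"
    by (rule sum_comp_quadratic[where f = chi, OF a chi_per])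
  also have "\<dots> = (\<Sum>z\<in>F. chi z + chi a * chi ((4 * a * z + 0) * ((4 * a * z + 0) + (b\<^sup>2 - 4 * a * c))))"
  proof (rule sum.cong[OF refl])
    fix z
    have "chi 4 = 1" using chi_square[of 2] not_dvd_2 by (simp add: ind_def)
    then have "chi a * chi (4 * a * z * (b\<^sup>2 - 4 * a * (c - z)))
        = chi z * chi (b\<^sup>2 - 4 * a * (c - z))"
      using chi_sq[of a] a by (simp add: chi_mult ind_def)
    then show "(1 + chi (b\<^sup>2 - 4 * a * (c - z))) * chi z
       = chi z + chi a * chi ((4 * a * z + 0) * ((4 * a * z + 0) + (b\<^sup>2 - 4 * a * c)))"
      by (simp add: algebra_simps)
  qed
  also have "\<dots> = chi a * (\<Sum>z\<in>F. chi ((4 * a * z + 0) * ((4 * a * z + 0) + (b\<^sup>2 - 4 * a * c))))"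
    by (simp add: sum.distrib sum_chi sum_distrib_left)
  also have "(\<Sum>z\<in>F. chi ((4 * a * z + 0) * ((4 * a * z + 0) + (b\<^sup>2 - 4 * a * c))))
     = (\<Sum>z\<in>F. chi (z * (z + (b\<^sup>2 - 4 * a * c))))"
    using a not_dvd_4 by (intro sum_affine[where f = "\<lambda>z. chi (z * (z + (b\<^sup>2 - 4 * a * c)))"])
       ((rule periodic_intros)+, simp add: dvd_mult_iff)
  finally show ?thesis by (simp add: sum_chi_two_linear[OF d])
qed


lemma sum_one_minus_ind: "(\<Sum>x\<in>F. 1 - ind x) = real p - 1"
  using sum_ind_affine[OF not_dvd_1, of 0] by (simp add: sum_subtractf)

section \<open>The second moment of \<open>G\<close>\<close>

text \<open>Orthogonality of characters of linear forms: only proportional forms (u', v') = c (u, v)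
  correlate. Then the product is chi(c) wherever the first form is nonzero, that is, at p^2 - p
  points. As \<open>u\<close> is a unit, at most one \<open>c\<close> contributes on the
  right.\<close>

lemma sum_chi_forms_unit:
  assumes u: "\<not> int p dvd u"
  shows "(\<Sum>A\<in>F. \<Sum>B\<in>F. chi (A * u + B * v) * chi (A * u' + B * v'))
    = ((real p)\<^sup>2 - real p) * (\<Sum>c\<in>F. chi c * (ind (c * u - u') * ind (c * v - v')))"
proof -
  define c where "c = u' * rinv u"
  define e where "e = v' - c * v"
  have "[u' * (u * rinv u) = u' * 1] (mod int p)"
    by (intro cong_mult cong_refl rinv u)
  then have cu: "[c * u = u'] (mod int p)" by (simp add: c_def algebra_simps)
  have "(\<Sum>x\<in>F. chi x * (ind (x * u - u') * ind (x * v - v')))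
      = (\<Sum>x\<in>F. ind (u * x + (- u')) * (chi x * ind (x * v - v')))"
    by (simp add: algebra_simps)
  also have "\<dots> = chi (- (- u') * rinv u) * ind (- (- u') * rinv u * v - v')"
    by (rule sum_ind_times[OF _ u]) (rule arg_cong2[where f = "(*)"]; (rule periodic_intros)+)
  also have "\<dots> = chi c * ind e"
    using ind_cong[of "c * v - v'" e] unfolding c_def e_def ind_def
    by (simp add: dvd_diff_commute)
  finally have R: "(\<Sum>x\<in>F. chi x * (ind (x * u - u') * ind (x * v - v'))) = chi c * ind e" .
  have "(\<Sum>A\<in>F. \<Sum>B\<in>F. chi (A * u + B * v) * chi (A * u' + B * v'))
     = (\<Sum>B\<in>F. \<Sum>A\<in>F. chi (A * u + B * v) * chi (A * u' + B * v'))"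
    by (rule sum.swap)
  \<comment> \<open>In the variable x = u A + v B the second form reads c x + e B, and
    \<open>e\<close> measures the failure of proportionality.\<close>
  also have "\<dots> = (\<Sum>B\<in>F. \<Sum>A\<in>F. chi (u * A + v * B) * chi (c * (u * A + v * B) + e * B))"
  proof (intro sum.cong refl arg_cong2[where f = "(*)"])
    fix A B
    show "chi (A * u + B * v) = chi (u * A + v * B)" by (simp add: algebra_simps)
    have "[A * u' + B * v' = A * (c * u) + B * v'] (mod int p)"
      by (intro cong_add cong_mult cong_refl cong_sym[OF cu])
    moreover have "A * (c * u) + B * v' = c * (u * A + v * B) + e * B"
      by (simp add: e_def algebra_simps)
    ultimately show "chi (A * u' + B * v') = chi (c * (u * A + v * B) + e * B)"
      using chi_cong by simp
  qed
  also have "\<dots> = (\<Sum>B\<in>F. \<Sum>x\<in>F. chi x * chi (c * x + e * B))"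
  proof (rule sum.cong[OF refl])
    fix B
    show "(\<Sum>A\<in>F. chi (u * A + v * B) * chi (c * (u * A + v * B) + e * B))
        = (\<Sum>x\<in>F. chi x * chi (c * x + e * B))"
      by (rule sum_affine[where f = "\<lambda>x. chi x * chi (c * x + e * B)", OF _ u])
         (rule arg_cong2[where f = "(*)"]; (rule periodic_intros)+)
  qed
  also have "\<dots> = ((real p)\<^sup>2 - real p) * (chi c * ind e)"
  proof (cases "int p dvd e")
    case True
    have "chi (c * x + e * B) = chi (c * x)" for x B
      using True by (intro chi_cong) (simp add: cong_iff_dvd_diff)
    then have "(\<Sum>B\<in>F. \<Sum>x\<in>F. chi x * chi (c * x + e * B))
       = (\<Sum>B\<in>F. \<Sum>x\<in>F. chi c * (1 - ind x))"
      by (simp add: chi_mult flip: chi_sq) (simp add: algebra_simps)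
    also have "\<dots> = real p * (chi c * (real p - 1))"
      by (simp add: sum_one_minus_ind flip: sum_distrib_left)
    finally show ?thesis using True by (simp add: ind_def algebra_simps power2_eq_square)
  next
    case False
    have "(\<Sum>B\<in>F. \<Sum>x\<in>F. chi x * chi (c * x + e * B))
       = (\<Sum>x\<in>F. \<Sum>B\<in>F. chi x * chi (e * B + c * x))"
      by (subst sum.swap) (simp add: add.commute)
    also have "\<dots> = 0"
      using sum_chi_affine[OF False] by (simp flip: sum_distrib_left)
    finally show ?thesis using False by (simp add: ind_def)
  qed
  finally show ?thesis unfolding R .
qed

lemma sum_chi_forms:
  "(\<Sum>A\<in>F. \<Sum>B\<in>F. chi (A * u + B * v) * chi (A * u' + B * v'))
    = ((real p)\<^sup>2 - real p) * (\<Sum>c\<in>F. chi c * (ind (c * u - u') * ind (c * v - v')))"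
proof -
  consider "\<not> int p dvd u" | "\<not> int p dvd v" | "int p dvd u" "int p dvd v" by blast
  then show ?thesis
  proof cases
    case 1 then show ?thesis by (rule sum_chi_forms_unit)
  next
    case 2
    have "(\<Sum>A\<in>F. \<Sum>B\<in>F. chi (A * u + B * v) * chi (A * u' + B * v'))
       = (\<Sum>B\<in>F. \<Sum>A\<in>F. chi (B * v + A * u) * chi (B * v' + A * u'))"
      by (subst sum.swap) (simp add: add.commute)
    also have "\<dots> = ((real p)\<^sup>2 - real p) * (\<Sum>c\<in>F. chi c * (ind (c * v - v') * ind (c * u - u')))"
      by (rule sum_chi_forms_unit[OF 2])
    finally show ?thesis by (simp add: mult.commute)
  next
    case 3
    have L: "chi (A * u + B * v) = 0" for A B
      using 3 by (simp add: chi_eq_0_iff)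
    \<comment> \<open>For the zero form the left side is 0. On the right the indicators no longer
      depend on \<open>c\<close>, so the sum of \<open>chi\<close> annihilates them.\<close>
    have "ind (c * u - u') * ind (c * v - v') = ind (- u') * ind (- v')" for c
      using 3 by (intro arg_cong2[where f = "(*)"] ind_cong) (auto simp: cong_iff_dvd_diff)
    then have "(\<Sum>c\<in>F. chi c * (ind (c * u - u') * ind (c * v - v'))) = 0"
      using sum_chi by (simp flip: sum_distrib_right)
    then show ?thesis by (simp add: L)
  qed
qed

text \<open>Expand the square over pairs (r, s), (r', s') and apply \<open>sum_chi_forms\<close>.
  For fixed \<open>c\<close> the conditions U r' = c U r and U s' = c U s are independent, so the
  count is a square.\<close>

lemma sum_square_chi_forms:
  fixes I :: "int set" and U :: "int \<Rightarrow> int"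
  shows "(\<Sum>A\<in>F. \<Sum>B\<in>F. (\<Sum>r\<in>I. \<Sum>s\<in>I. chi (A * U s + B * U r))\<^sup>2)
    = ((real p)\<^sup>2 - real p) * (\<Sum>c\<in>F. chi c * (\<Sum>r\<in>I. \<Sum>r'\<in>I. ind (c * U r - U r'))\<^sup>2)"
proof -
  let ?J = "I \<times> I"
  let ?K = "(real p)\<^sup>2 - real p"
  have "(\<Sum>A\<in>F. \<Sum>B\<in>F. (\<Sum>r\<in>I. \<Sum>s\<in>I. chi (A * U s + B * U r))\<^sup>2)
    = (\<Sum>A\<in>F. \<Sum>B\<in>F. \<Sum>z\<in>?J. \<Sum>z'\<in>?J.
        chi (A * U (snd z) + B * U (fst z)) * chi (A * U (snd z') + B * U (fst z')))"
    by (simp add: sum.cartesian_product power2_eq_square sum_product case_prod_unfold)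
  also have "\<dots> = (\<Sum>A\<in>F. \<Sum>z\<in>?J. \<Sum>B\<in>F. \<Sum>z'\<in>?J.
        chi (A * U (snd z) + B * U (fst z)) * chi (A * U (snd z') + B * U (fst z')))"
    by (intro sum.cong refl sum.swap)
  also have "\<dots> = (\<Sum>z\<in>?J. \<Sum>A\<in>F. \<Sum>B\<in>F. \<Sum>z'\<in>?J.
        chi (A * U (snd z) + B * U (fst z)) * chi (A * U (snd z') + B * U (fst z')))"
    by (rule sum.swap)
  also have "\<dots> = (\<Sum>z\<in>?J. \<Sum>A\<in>F. \<Sum>z'\<in>?J. \<Sum>B\<in>F.
        chi (A * U (snd z) + B * U (fst z)) * chi (A * U (snd z') + B * U (fst z')))"
    by (intro sum.cong refl sum.swap)
  also have "\<dots> = (\<Sum>z\<in>?J. \<Sum>z'\<in>?J. \<Sum>A\<in>F. \<Sum>B\<in>F.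
        chi (A * U (snd z) + B * U (fst z)) * chi (A * U (snd z') + B * U (fst z')))"
    by (intro sum.cong refl sum.swap)
  also have "\<dots> = ?K * (\<Sum>z\<in>?J. \<Sum>z'\<in>?J. \<Sum>c\<in>F.
      chi c * (ind (c * U (snd z) - U (snd z')) * ind (c * U (fst z) - U (fst z'))))"
    by (simp add: sum_chi_forms sum_distrib_left)
  also have "(\<Sum>z\<in>?J. \<Sum>z'\<in>?J. \<Sum>c\<in>F.
      chi c * (ind (c * U (snd z) - U (snd z')) * ind (c * U (fst z) - U (fst z'))))
    = (\<Sum>z\<in>?J. \<Sum>c\<in>F. \<Sum>z'\<in>?J.
      chi c * (ind (c * U (snd z) - U (snd z')) * ind (c * U (fst z) - U (fst z'))))"
    by (intro sum.cong refl sum.swap)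
  also have "\<dots> = (\<Sum>c\<in>F. \<Sum>z\<in>?J. \<Sum>z'\<in>?J.
      chi c * (ind (c * U (snd z) - U (snd z')) * ind (c * U (fst z) - U (fst z'))))"
    by (rule sum.swap)
  also have "\<dots> = (\<Sum>c\<in>F. chi c * (\<Sum>r\<in>I. \<Sum>r'\<in>I. ind (c * U r - U r'))\<^sup>2)"
  proof (rule sum.cong[OF refl])
    fix c
    have "(\<Sum>r\<in>I. \<Sum>r'\<in>I. ind (c * U r - U r'))\<^sup>2
      = (\<Sum>r\<in>I. \<Sum>s\<in>I. (\<Sum>r'\<in>I. ind (c * U r - U r')) * (\<Sum>s'\<in>I. ind (c * U s - U s')))"
      by (simp add: power2_eq_square sum_product)
    also have "\<dots> = (\<Sum>r\<in>I. \<Sum>s\<in>I. \<Sum>r'\<in>I. \<Sum>s'\<in>I. ind (c * U r - U r') * ind (c * U s - U s'))"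
      by (simp add: sum_product)
    also have "\<dots> = (\<Sum>z\<in>?J. \<Sum>z'\<in>?J.
      ind (c * U (snd z) - U (snd z')) * ind (c * U (fst z) - U (fst z')))"
      by (simp add: sum.cartesian_product' mult.commute)
    finally show "(\<Sum>z\<in>?J. \<Sum>z'\<in>?J.
      chi c * (ind (c * U (snd z) - U (snd z')) * ind (c * U (fst z) - U (fst z'))))
      = chi c * (\<Sum>r\<in>I. \<Sum>r'\<in>I. ind (c * U r - U r'))\<^sup>2"
      by (simp add: sum_distrib_left)
  qed
  finally show ?thesis .
qed

section \<open>Counting the solutions of U(r') = c U(r)\<close>

definition U :: "int \<Rightarrow> int" where "U s = (s - 1)\<^sup>2 * rinv s"

definition G :: "int \<Rightarrow> int \<Rightarrow> real" where
  "G A B = (\<Sum>r\<in>F - {0}. \<Sum>s\<in>F - {0}. chi (A * U s + B * U r))"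

definition N :: "int \<Rightarrow> real" where
  "N c = (\<Sum>r\<in>F - {0}. \<Sum>r'\<in>F - {0}. ind (c * U r - U r'))"

lemma unit_in_F: "r \<in> F - {0} \<Longrightarrow> \<not> int p dvd r"
  using dvd_F_iff by auto

lemma card_units: "real (card (F - {0})) = real p - 1"
  using p_gt_2 by (simp add: of_nat_diff)

text \<open>Clearing denominators makes the condition a quadratic in \<open>r'\<close> with leading
  and constant coefficient -r. The value r' = 0 is therefore never a root, and the count is read off
  from the discriminant.\<close>

lemma sum_ind_U:
  assumes r: "r \<in> F - {0}"
  shows "(\<Sum>r'\<in>F - {0}. ind (c * U r - U r'))
    = 1 + chi ((r - 1)\<^sup>2 * (c * (c * r\<^sup>2 + (4 - 2 * c) * r + c)))"
proof -
  note ur = unit_in_F[OF r]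
  have "ind (c * U r - U r') = ind ((- r) * r'\<^sup>2 + (2 * r + c * (r - 1)\<^sup>2) * r' + (- r))"
    if r': "r' \<in> F - {0}" for r'
  proof -
    note ur' = unit_in_F[OF r']
    have "ind (c * U r - U r') = ind ((r * r') * (c * U r - U r'))"
      using ur ur' by (simp add: ind_def dvd_mult_iff)
    also have "(r * r') * (c * U r - U r')
        = c * (r - 1)\<^sup>2 * r' * (r * rinv r) - (r' - 1)\<^sup>2 * r * (r' * rinv r')"
      by (simp add: U_def algebra_simps)
    also have "ind \<dots> = ind (c * (r - 1)\<^sup>2 * r' * 1 - (r' - 1)\<^sup>2 * r * 1)"
      by (intro ind_cong cong_diff cong_mult cong_refl rinv ur ur')
    also have "c * (r - 1)\<^sup>2 * r' * 1 - (r' - 1)\<^sup>2 * r * 1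
        = (- r) * r'\<^sup>2 + (2 * r + c * (r - 1)\<^sup>2) * r' + (- r)"
      by (simp add: algebra_simps power2_eq_square)
    finally show ?thesis .
  qed
  then have "(\<Sum>r'\<in>F - {0}. ind (c * U r - U r'))
     = (\<Sum>r'\<in>F - {0}. ind ((- r) * r'\<^sup>2 + (2 * r + c * (r - 1)\<^sup>2) * r' + (- r)))"
    by simp
  also have "\<dots> = (\<Sum>r'\<in>F. ind ((- r) * r'\<^sup>2 + (2 * r + c * (r - 1)\<^sup>2) * r' + (- r)))"
    using ur sum_F_split[of "\<lambda>r'. ind ((- r) * r'\<^sup>2 + (2 * r + c * (r - 1)\<^sup>2) * r' + (- r))"]
    by (simp add: ind_def)
  also have "\<dots> = 1 + chi ((2 * r + c * (r - 1)\<^sup>2)\<^sup>2 - 4 * (- r) * (- r))"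
    using ur by (intro sum_ind_quadratic) simp
  also have "(2 * r + c * (r - 1)\<^sup>2)\<^sup>2 - 4 * (- r) * (- r)
     = (r - 1)\<^sup>2 * (c * (c * r\<^sup>2 + (4 - 2 * c) * r + c))"
    by (simp add: algebra_simps power2_eq_square)
  finally show ?thesis .
qed

lemma N_nonneg: "0 \<le> N c"
  unfolding N_def ind_def by (intro sum_nonneg) auto

lemma N_le: "N c \<le> 2 * real p"
proof -
  have "N c \<le> (\<Sum>r\<in>F - {0}. 2)"
    unfolding N_def
  proof (rule sum_mono)
    fix r assume "r \<in> F - {0}"
    then show "(\<Sum>r'\<in>F - {0}. ind (c * U r - U r')) \<le> 2"
      using sum_ind_U[of r c] abs_chi_le[of "(r - 1)\<^sup>2 * (c * (c * r\<^sup>2 + (4 - 2 * c) * r + c))"]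
      by simp
  qed
  also have "\<dots> \<le> 2 * real p" using p_gt_2 by simp
  finally show ?thesis .
qed

lemma chi_4: "chi 4 = 1"
  using chi_square[of 2] not_dvd_2 by (simp add: ind_def)

text \<open>In the discriminant from \<open>sum_ind_U\<close> the square (r - 1)^2 only removes r =
  1. What remains is a quadratic in \<open>r\<close> of discriminant 16 (1 - c), nonzero here, so
  its character sum is bounded.\<close>

lemma N_approx:
  assumes c: "\<not> int p dvd c" "\<not> int p dvd 1 - c"
  shows "\<bar>N c - real p\<bar> \<le> 4"
proof -
  let ?q = "\<lambda>r. c * r\<^sup>2 + (4 - 2 * c) * r + c"
  have "N c = (\<Sum>r\<in>F - {0}. 1 + chi c * ((1 - ind (r - 1)) * chi (?q r)))"
    unfolding N_def by (intro sum.cong refl) (simp add: sum_ind_U chi_mult chi_square)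
  also have "\<dots> = (real p - 1) + chi c * (\<Sum>r\<in>F - {0}. (1 - ind (r - 1)) * chi (?q r))"
    by (simp add: sum.distrib card_units sum_distrib_left)
  also have "(\<Sum>r\<in>F - {0}. (1 - ind (r - 1)) * chi (?q r))
     = (\<Sum>r\<in>F. (1 - ind (r - 1)) * chi (?q r)) - chi c"
    using not_dvd_1 by (subst sum_F_split) (simp add: ind_def)
  also have "(\<Sum>r\<in>F. (1 - ind (r - 1)) * chi (?q r))
     = (\<Sum>r\<in>F. chi (?q r)) - (\<Sum>r\<in>F. ind (1 * r + (-1)) * chi (?q r))"
    by (simp add: algebra_simps sum_subtractf)
  also have "(\<Sum>r\<in>F. ind (1 * r + (-1)) * chi (?q r)) = chi (?q (- (-1) * rinv 1))"
    by (rule sum_ind_times[where f = "\<lambda>r. chi (?q r)", OF _ not_dvd_1]) ((rule periodic_intros)+)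
  \<comment> \<open>At r = 1 the quadratic equals 4, a nonzero square.\<close>
  also have "\<dots> = 1" by (simp add: rinv_def chi_4)
  also have "(\<Sum>r\<in>F. chi (?q r)) = - chi c"
  proof (rule sum_chi_quadratic[OF c(1)])
    have "(4 - 2 * c)\<^sup>2 - 4 * c * c = 4 * (4 * (1 - c))"
      by (simp add: algebra_simps power2_eq_square)
    then show "\<not> int p dvd (4 - 2 * c)\<^sup>2 - 4 * c * c"
      using c not_dvd_4 by (simp only: dvd_mult_iff) simp
  qed
  finally have "N c - real p = - 1 - chi c - 2 * (chi c * chi c)"
    by (simp add: algebra_simps)
  then show ?thesis using chi_cases[of c] by auto
qed

text \<open>The main term N(c) ~ p is cancelled by the sum of \<open>chi\<close>, so N(c)^2 may be
  replaced by N(c)^2 - p^2. This is O(p) except at c = 1, where it is O(p^2).\<close>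

lemma sum_G_square: "(\<Sum>A\<in>F. \<Sum>B\<in>F. (G A B)\<^sup>2) \<le> 15 * real p ^ 4"
proof -
  let ?p = "real p"
  have "(\<Sum>c\<in>F. chi c * (N c)\<^sup>2) = (\<Sum>c\<in>F. chi c * ((N c)\<^sup>2 - ?p\<^sup>2))"
    using sum_chi by (simp add: right_diff_distrib sum_subtractf flip: sum_distrib_right)
  \<comment> \<open>For generic \<open>c\<close> the factors of N^2 - p^2 are at most 4 and 3p; at c
    = 1 the bound N \<le> 2p gives 3p^2. The total is 12 p^2 + 3 p^2.\<close>
  also have "\<dots> \<le> (\<Sum>c\<in>F. 12 * ?p + (if c = 1 then 3 * ?p\<^sup>2 else 0))"
  proof (rule sum_mono)
    fix c assume c: "c \<in> F"
    have n: "0 \<le> N c" "N c \<le> 2 * ?p" by (rule N_nonneg, rule N_le)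
    have p: "?p \<ge> 0" by simp
    have sq: "(N c)\<^sup>2 - ?p\<^sup>2 = (N c - ?p) * (N c + ?p)"
      by (simp add: algebra_simps power2_eq_square)
    consider "c = 0" | "c = 1" | "c \<noteq> 0" "c \<noteq> 1" by blast
    then show "chi c * ((N c)\<^sup>2 - ?p\<^sup>2) \<le> 12 * ?p + (if c = 1 then 3 * ?p\<^sup>2 else 0)"
    proof cases
      case 1 then show ?thesis by (simp add: chi_def Legendre_def)
    next
      case 2
      have "(N c)\<^sup>2 \<le> (2 * ?p)\<^sup>2" using n by (intro power_mono) auto
      then show ?thesis using 2 by (simp add: chi_1 power_mult_distrib)
    next
      case 3
      have "\<bar>N c - ?p\<bar> \<le> 4"
      proof (rule N_approx)
        show "\<not> int p dvd c" using c 3 dvd_F_iff by auto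
        show "\<not> int p dvd 1 - c"
        proof
          assume "int p dvd 1 - c"
          then have "[1 = c] (mod int p)" by (simp add: cong_iff_dvd_diff)
          then show False using 3 c cong_in_F_eq[of 1 c] p_gt_2 by auto
        qed
      qed
      then have "\<bar>chi c\<bar> * (\<bar>N c - ?p\<bar> * \<bar>N c + ?p\<bar>) \<le> 1 * (4 * (3 * ?p))"
        using n abs_chi_le[of c] by (intro mult_mono) auto
      then show ?thesis using 3 unfolding sq by (simp flip: abs_mult)
    qed
  qed
  also have "\<dots> = 15 * ?p\<^sup>2" using p_gt_2 by (simp add: sum.distrib power2_eq_square)
  finally have s: "(\<Sum>c\<in>F. chi c * (N c)\<^sup>2) \<le> 15 * ?p\<^sup>2" .
  have "(\<Sum>A\<in>F. \<Sum>B\<in>F. (G A B)\<^sup>2) = (?p\<^sup>2 - ?p) * (\<Sum>c\<in>F. chi c * (N c)\<^sup>2)"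
    unfolding G_def N_def by (rule sum_square_chi_forms)
  also have "\<dots> \<le> (?p\<^sup>2 - ?p) * (15 * ?p\<^sup>2)"
    using s p_gt_2 by (intro mult_left_mono) (auto simp: power2_eq_square)
  also have "\<dots> \<le> ?p\<^sup>2 * (15 * ?p\<^sup>2)"
    by (intro mult_right_mono) auto
  finally show ?thesis by (simp add: power2_eq_square power4_eq_xxxx algebra_simps)
qed


section \<open>Squares of elliptic sums\<close>

text \<open>For a unit \<open>v\<close>, chi(u v) = chi(u/v), and the sum selects t = u/v. For v = 0
  both sides vanish.\<close>

lemma chi_mult_eq_sum: "chi (u * v) = (\<Sum>t\<in>F. chi t * ind (t * v - u))"
proof (cases "int p dvd v")
  case True
  have "ind (t * v - u) = ind (- u)" for t
    using True by (intro ind_cong) (simp add: cong_iff_dvd_diff)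
  then have "(\<Sum>t\<in>F. chi t * ind (t * v - u)) = 0"
    using sum_chi by (simp flip: sum_distrib_right)
  then show ?thesis using True by (simp add: chi_eq_0_iff)
next
  case False
  have "(\<Sum>t\<in>F. chi t * ind (t * v - u)) = (\<Sum>t\<in>F. ind (v * t + (- u)) * chi t)"
    by (simp add: algebra_simps)
  also have "\<dots> = chi (- (- u) * rinv v)"
    by (rule sum_ind_times[where f = chi, OF chi_per False])
  finally show ?thesis by (simp add: chi_mult chi_rinv)
qed

text \<open>After y = r x the sum is over \<open>x\<close>, \<open>r\<close> and the ratio t = q(x)
  / q(r x). For given \<open>r\<close>, \<open>t\<close> the number of \<open>x\<close> is the root
  count of a quadratic, 1 + chi of its discriminant; the 1 cancels and the discriminant part is
  exactly \<open>G\<close>. The error comes from degenerate quadratics.\<close>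

lemma square_sum_chi_approx_G:
  assumes a: "\<not> int p dvd a" and c: "\<not> int p dvd c"
  shows "\<bar>(\<Sum>x\<in>F. chi (x * (a * x\<^sup>2 + b * x + c)))\<^sup>2 - G (b\<^sup>2 - 4 * a * c) (4 * a * c)\<bar> \<le> 4 * real p"
proof -
  define q where "q x = a * x\<^sup>2 + b * x + c" for x
  define A where "A = b\<^sup>2 - 4 * a * c"
  define B where "B = 4 * a * c"
  \<comment> \<open>The discriminant of t q(r x) - q(x) as a quadratic in \<open>x\<close>.\<close>
  define D where "D r t = A * (1 - t * r)\<^sup>2 + B * t * (1 - r)\<^sup>2" for r t
  define n where "n r t = (\<Sum>x\<in>F. ind (t * q (r * x) - q x))" for r t
  define err where "err r t = n r t - 1 - chi (D r t)" for r t
  define W where "W = (\<Sum>x\<in>F. chi (x * q x))"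
  have q_cong: "[q x = q y] (mod int p)" if "[x = y] (mod int p)" for x y
    unfolding q_def by (intro cong_add cong_mult cong_pow cong_refl that)
  \<comment> \<open>Substitute \<open>y = r x\<close>; the terms with \<open>x = 0\<close> cancel when summed over \<open>r\<close>.\<close>
  have "W\<^sup>2 = (\<Sum>x\<in>F. \<Sum>y\<in>F. chi (x * q x) * chi (y * q y))"
    by (simp add: W_def power2_eq_square sum_product)
  also have "\<dots> = (\<Sum>x\<in>F. \<Sum>r\<in>F. chi r * chi (q x * q (r * x)))"
  proof (rule sum.cong[OF refl])
    fix x assume x: "x \<in> F"
    show "(\<Sum>y\<in>F. chi (x * q x) * chi (y * q y)) = (\<Sum>r\<in>F. chi r * chi (q x * q (r * x)))"
    proof (cases "x = 0")
      case True
      then show ?thesis using sum_chi by (simp add: chi_0 flip: sum_distrib_right)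
    next
      case False
      then have ux: "\<not> int p dvd x" using x dvd_F_iff by auto
      have "(\<Sum>r\<in>F. chi (x * q x) * chi ((x * r + 0) * q (x * r + 0)))
        = (\<Sum>y\<in>F. chi (x * q x) * chi (y * q y))"
        by (rule sum_affine[where f = "\<lambda>y. chi (x * q x) * chi (y * q y)", OF _ ux])
           (rule arg_cong2[where f = "(*)"]; (rule periodic_intros q_cong)+)
      moreover have "chi (x * q x) * chi ((x * r + 0) * q (x * r + 0)) = chi r * chi (q x * q (r * x))" for r
        using chi_sq[of x] ux by (simp add: chi_mult ind_def mult.commute[of x r])
      ultimately show ?thesis by simp
    qed
  qed
  also have "\<dots> = (\<Sum>r\<in>F. \<Sum>x\<in>F. chi r * (\<Sum>t\<in>F. chi t * ind (t * q (r * x) - q x)))"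
    by (subst sum.swap) (simp only: chi_mult_eq_sum)
  also have "\<dots> = (\<Sum>r\<in>F. \<Sum>x\<in>F. \<Sum>t\<in>F. chi r * chi t * ind (t * q (r * x) - q x))"
    by (simp add: sum_distrib_left mult.assoc)
  also have "\<dots> = (\<Sum>r\<in>F. \<Sum>t\<in>F. \<Sum>x\<in>F. chi r * chi t * ind (t * q (r * x) - q x))"
    by (intro sum.cong refl sum.swap)
  also have "\<dots> = (\<Sum>r\<in>F. \<Sum>t\<in>F. chi r * chi t * n r t)"
    by (simp add: n_def sum_distrib_left)
  also have "\<dots> = (\<Sum>r\<in>F. \<Sum>t\<in>F. chi r * chi t) + (\<Sum>r\<in>F. \<Sum>t\<in>F. chi r * chi t * chi (D r t))
      + (\<Sum>r\<in>F. \<Sum>t\<in>F. chi r * chi t * err r t)"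
    by (simp add: err_def algebra_simps flip: sum.distrib)
  also have "(\<Sum>r\<in>F. \<Sum>t\<in>F. chi r * chi t) = 0"
    using sum_chi by (simp flip: sum_distrib_left)
  also have "(\<Sum>r\<in>F. \<Sum>t\<in>F. chi r * chi t * chi (D r t)) = G A B"
  proof -
    have "(\<Sum>r\<in>F. \<Sum>t\<in>F. chi r * chi t * chi (D r t))
      = (\<Sum>r\<in>F - {0}. \<Sum>t\<in>F. chi r * chi t * chi (D r t))"
      using sum_F_split[of "\<lambda>r. \<Sum>t\<in>F. chi r * chi t * chi (D r t)"] by (simp add: chi_0)
    also have "\<dots> = G A B" unfolding G_def
    proof (rule sum.cong[OF refl])
      fix r assume "r \<in> F - {0}"
      then have ur: "\<not> int p dvd r" by (rule unit_in_F)
      \<comment> \<open>Put t = s/r. Then chi(r) chi(t) = chi(s) = chi(1/s), and D/s = A U(s) + B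
        U(r).\<close>
      have "(\<Sum>t\<in>F. chi r * chi t * chi (D r t))
         = (\<Sum>s\<in>F. chi r * chi (rinv r * s + 0) * chi (D r (rinv r * s + 0)))"
        by (rule sum_affine[where f = "\<lambda>t. chi r * chi t * chi (D r t)", symmetric])
           (unfold D_def, rule arg_cong2[where f = "(*)"], rule arg_cong2[where f = "(*)"],
             (rule refl periodic_intros)+, simp add: rinv_dvd_iff ur)
      also have "\<dots> = (\<Sum>s\<in>F - {0}. chi r * chi (rinv r * s + 0) * chi (D r (rinv r * s + 0)))"
        by (subst sum_F_split) (simp add: chi_eq_0_iff)
      also have "\<dots> = (\<Sum>s\<in>F - {0}. chi (A * U s + B * U r))"
      proof (rule sum.cong[OF refl])
        fix s assume "s \<in> F - {0}"
        then have us: "\<not> int p dvd s" by (rule unit_in_F)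
        have "chi r * chi (rinv r * s + 0) * chi (D r (rinv r * s + 0)) = chi (rinv s * D r (rinv r * s))"
          using chi_sq[of r] ur by (simp add: chi_mult chi_rinv ind_def)
        also have "rinv s * D r (rinv r * s)
           = A * (1 - s * (r * rinv r))\<^sup>2 * rinv s + B * rinv r * (1 - r)\<^sup>2 * (s * rinv s)"
          by (simp add: D_def algebra_simps)
        also have "chi \<dots> = chi (A * (1 - s * 1)\<^sup>2 * rinv s + B * rinv r * (1 - r)\<^sup>2 * 1)"
          by (intro chi_cong cong_add cong_mult cong_pow cong_diff cong_refl rinv ur us)
        also have "A * (1 - s * 1)\<^sup>2 * rinv s + B * rinv r * (1 - r)\<^sup>2 * 1 = A * U s + B * U r"
          by (simp add: U_def power2_commute[of 1] algebra_simps)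
        finally show "chi r * chi (rinv r * s + 0) * chi (D r (rinv r * s + 0))
           = chi (A * U s + B * U r)" .
      qed
      finally show "(\<Sum>t\<in>F. chi r * chi t * chi (D r t)) = (\<Sum>s\<in>F - {0}. chi (A * U s + B * U r))" .
    qed
    finally show ?thesis .
  qed
  finally have W2: "W\<^sup>2 - G A B = (\<Sum>r\<in>F. \<Sum>t\<in>F. chi r * chi t * err r t)" by simp
  \<comment> \<open>\<open>err r t\<close> vanishes unless \<open>t r\<^sup>2 = 1\<close>, where the quadratic in \<open>x\<close> degenerates; it is then at most
    \<open>2\<close>, except for \<open>r = \<plusminus>1\<close>.\<close>
  have n_eq: "n r t = (\<Sum>x\<in>F. ind ((a * (t * r\<^sup>2 - 1)) * x\<^sup>2 + (b * (t * r - 1)) * x + c * (t - 1)))" for r t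
    unfolding n_def q_def by (simp add: algebra_simps power2_eq_square)
  have n_nonneg: "0 \<le> n r t" for r t
    unfolding n_def ind_def by (intro sum_nonneg) auto
  have n_le: "n r t \<le> real p" for r t
    using sum_bounded_above[of F "\<lambda>x. ind (t * q (r * x) - q x)" 1]
    by (simp add: n_def ind_def)
  have err_le: "\<bar>chi r * chi t * err r t\<bar> \<le> ind (r\<^sup>2 * t + (-1)) * (2 + real p * ind (1 * r\<^sup>2 + 0 * r + (-1)))" for r t
  proof (cases "int p dvd t * r\<^sup>2 - 1")
    case False
    then have "n r t = 1 + chi ((b * (t * r - 1))\<^sup>2 - 4 * (a * (t * r\<^sup>2 - 1)) * (c * (t - 1)))"
      unfolding n_eq using a by (intro sum_ind_quadratic) (simp add: dvd_mult_iff)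
    also have "(b * (t * r - 1))\<^sup>2 - 4 * (a * (t * r\<^sup>2 - 1)) * (c * (t - 1)) = D r t"
      by (simp add: D_def A_def B_def algebra_simps power2_eq_square)
    finally show ?thesis by (simp add: err_def ind_def)
  next
    case True
    then have i: "ind (r\<^sup>2 * t + (-1)) = 1" by (simp add: ind_def mult.commute)
    \<comment> \<open>For r^2 = 1 the trivial bound p is used. Otherwise t = 1 is excluded, so the
      remaining linear polynomial has the nonzero constant term c (t - 1) and at most one
      root.\<close>
    have "n r t \<le> 1 + real p * ind (1 * r\<^sup>2 + 0 * r + (-1))"
    proof (cases "int p dvd r\<^sup>2 - 1")
      case True then show ?thesis using n_le[of r t] by (simp add: ind_def)
    next
      case False
      have t: "\<not> int p dvd t - 1"
      proof
        assume "int p dvd t - 1"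
        then have "int p dvd (t * r\<^sup>2 - 1) - (t - 1) * r\<^sup>2"
          by (intro dvd_diff[OF True] dvd_mult2)
        then show False using False by (simp add: algebra_simps)
      qed
      have "n r t = (\<Sum>x\<in>F. ind ((b * (t * r - 1)) * x + c * (t - 1)))"
        unfolding n_eq using True
        by (intro sum.cong refl ind_cong) (simp add: cong_iff_dvd_diff)
      also have "\<dots> \<le> 1"
      proof (cases "int p dvd b * (t * r - 1)")
        case True
        have "ind ((b * (t * r - 1)) * x + c * (t - 1)) = ind (c * (t - 1))" for x
          using True by (intro ind_cong) (simp add: cong_iff_dvd_diff)
        then show ?thesis using t c by (simp add: ind_def dvd_mult_iff)
      next
        case False
        then show ?thesis using sum_ind_affine[OF False] by simp
      qed
      finally show ?thesis by (simp add: ind_def)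
    qed
    then have e: "\<bar>err r t\<bar> \<le> 2 + real p * ind (1 * r\<^sup>2 + 0 * r + (-1))"
      using n_nonneg[of r t] abs_chi_le[of "D r t"] by (auto simp: err_def ind_def split: if_splits)
    have "\<bar>chi r * chi t\<bar> * \<bar>err r t\<bar> \<le> 1 * \<bar>err r t\<bar>"
      using abs_chi_le[of "r * t"] by (intro mult_right_mono) (auto simp: chi_mult)
    then show ?thesis unfolding i using e by (simp add: abs_mult)
  qed
  have "\<bar>W\<^sup>2 - G A B\<bar> \<le> (\<Sum>r\<in>F. \<Sum>t\<in>F. \<bar>chi r * chi t * err r t\<bar>)"
    unfolding W2 by (rule order.trans[OF sum_abs sum_mono]) (rule sum_abs)
  also have "\<dots> \<le> (\<Sum>r\<in>F. \<Sum>t\<in>F. ind (r\<^sup>2 * t + (-1)) * (2 + real p * ind (1 * r\<^sup>2 + 0 * r + (-1))))"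
    by (intro sum_mono err_le)
  also have "\<dots> = (\<Sum>r\<in>F. (\<Sum>t\<in>F. ind (r\<^sup>2 * t + (-1))) * (2 + real p * ind (1 * r\<^sup>2 + 0 * r + (-1))))"
    by (simp add: sum_distrib_right)
  also have "\<dots> \<le> (\<Sum>r\<in>F. 1 * (2 + real p * ind (1 * r\<^sup>2 + 0 * r + (-1))))"
  proof (intro sum_mono mult_right_mono)
    fix r
    show "(\<Sum>t\<in>F. ind (r\<^sup>2 * t + (-1))) \<le> 1"
    proof (cases "int p dvd r\<^sup>2")
      case True
      have "ind (r\<^sup>2 * t + (-1)) = ind (-1)" for t
        using True by (intro ind_cong) (simp add: cong_iff_dvd_diff)
      then show ?thesis using not_dvd_1 by (simp add: ind_def)
    next
      case False
      then show ?thesis using sum_ind_affine[OF False, of "-1"] by simp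
    qed
  qed (auto simp: ind_def)
  \<comment> \<open>Each \<open>r\<close> admits at most one \<open>t\<close>, with error 2; the two
    values r = 1, -1 add p each. Together this is 4p.\<close>
  also have "\<dots> = 2 * real p + real p * (\<Sum>r\<in>F. ind (1 * r\<^sup>2 + 0 * r + (-1)))"
    by (simp add: sum.distrib sum_distrib_left)
  also have "(\<Sum>r\<in>F. ind (1 * r\<^sup>2 + 0 * r + (-1))) = 2"
    by (subst sum_ind_quadratic[OF not_dvd_1]) (simp add: chi_4)
  finally show ?thesis unfolding W_def q_def A_def B_def by simp
qed


section \<open>Fourth moments of elliptic sums\<close>

text \<open>The sum over the quartic a (a - 1) (a + m) (a + n) after w = 1 - 1/a, which sends the
  root 0 to infinity and the root 1 to 0; see \<open>sum_chi_quartic_eq_W\<close>.\<close>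

definition W :: "int \<Rightarrow> int \<Rightarrow> real" where
  "W m n = (\<Sum>w\<in>F. chi (w * ((m * w - (1 + m)) * (n * w - (1 + n)))))"

lemma W_commute: "W m n = W n m"
  unfolding W_def by (simp add: mult.commute)

lemma G_periodic: "G (A mod int p) B = G A B" "G A (B mod int p) = G A B"
  unfolding G_def by (intro sum.cong refl; (rule periodic_intros)+)+

lemma abs_chi_sum_le: "\<bar>\<Sum>x\<in>F. chi (h x)\<bar> \<le> real p"
  using order.trans[OF sum_abs sum_bounded_above[of F "\<lambda>x. \<bar>chi (h x)\<bar>" 1]] abs_chi_le by simp

text \<open>For m = 0 the cubic drops to a quadratic with distinct roots. For m = -1 it contains
  w^2, leaving the sum of a linear character without its term at w = 0. Both sums are
  explicit.\<close>

lemma W_special: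
  assumes m: "int p dvd m \<or> int p dvd 1 + m" and n: "\<not> int p dvd n" "\<not> int p dvd 1 + n"
  shows "\<bar>W m n\<bar> \<le> 1"
  using m
proof
  assume m: "int p dvd m"
  have "W m n = (\<Sum>w\<in>F. chi (-1) * chi (n * w\<^sup>2 + (- (1 + n)) * w + 0))"
    unfolding W_def
  proof (rule sum.cong[OF refl])
    fix w
    have "[w * ((m * w - (1 + m)) * (n * w - (1 + n))) = w * ((0 * w - (1 + 0)) * (n * w - (1 + n)))] (mod int p)"
      using m by (intro cong_mult cong_diff cong_add cong_refl) (simp_all add: cong_0_iff)
    moreover have "w * ((0 * w - (1 + 0)) * (n * w - (1 + n))) = (-1) * (n * w\<^sup>2 + (- (1 + n)) * w + 0)"
      by (simp add: algebra_simps power2_eq_square)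
    ultimately show "chi (w * ((m * w - (1 + m)) * (n * w - (1 + n)))) = chi (-1) * chi (n * w\<^sup>2 + (- (1 + n)) * w + 0)"
      using chi_cong by (metis chi_mult)
  qed
  also have "\<dots> = chi (-1) * (- chi n)"
    using n by (subst sum_distrib_left[symmetric], subst sum_chi_quadratic)
      (simp_all add: dvd_pow2_iff dvd_minus_iff[of "int p" "1 + n", simplified])
  also have "\<dots> = - chi (- 1 * n)" by (simp only: chi_mult mult_minus_right)
  finally show ?thesis using abs_chi_le[of "-1 * n"] by simp
next
  assume m: "int p dvd 1 + m"
  have "W m n = (\<Sum>w\<in>F. chi (-1) * ((1 - ind w) * chi (n * w + (- (1 + n)))))"
    unfolding W_def
  proof (rule sum.cong[OF refl])
    fix w
    have "[m = -1] (mod int p)" using m by (simp add: cong_iff_dvd_diff add.commute)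
    then have "[w * ((m * w - (1 + m)) * (n * w - (1 + n))) = w * (((-1) * w - (1 + (-1))) * (n * w - (1 + n)))] (mod int p)"
      by (intro cong_mult cong_diff cong_add cong_refl)
    moreover have "w * (((-1) * w - (1 + (-1))) * (n * w - (1 + n))) = (-1) * (w\<^sup>2 * (n * w + (- (1 + n))))"
      by (simp add: algebra_simps power2_eq_square)
    ultimately show "chi (w * ((m * w - (1 + m)) * (n * w - (1 + n)))) = chi (-1) * ((1 - ind w) * chi (n * w + (- (1 + n))))"
      using chi_cong by (metis chi_mult chi_square)
  qed
  also have "\<dots> = chi (-1) * ((\<Sum>w\<in>F. chi (n * w + (- (1 + n)))) - (\<Sum>w\<in>F. ind (1 * w + 0) * chi (n * w + (- (1 + n)))))"
    by (simp add: left_diff_distrib sum_subtractf flip: sum_distrib_left)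
  also have "(\<Sum>w\<in>F. ind (1 * w + 0) * chi (n * w + (- (1 + n)))) = chi (n * (- 0 * rinv 1) + (- (1 + n)))"
    by (rule sum_ind_times[where f = "\<lambda>w. chi (n * w + (- (1 + n)))", OF _ not_dvd_1]) ((rule periodic_intros)+)
  also have "(\<Sum>w\<in>F. chi (n * w + (- (1 + n)))) = 0"
    by (rule sum_chi_affine[OF n(1)])
  also have "chi (-1) * (0 - chi (n * (- 0 * rinv 1) + (- (1 + n)))) = - chi (-1 * (n * (- 0 * rinv 1) + (- (1 + n))))"
    by (simp only: chi_mult[of "-1"]) simp
  finally show ?thesis using abs_chi_le[of "-1 * (n * (- 0 * rinv 1) + (- (1 + n)))"] by simp
qed

text \<open>If both parameters lie in {0, -1}, the trivial bound p is used; if exactly one does, |W|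
  \<le> 1. Otherwise W^2 is within 4p of \<open>G\<close> at the displayed arguments, and W^4 \<le>
  2 g^2 + 2 (W^2 - g)^2 with 2 (4p)^2 = 32 p^2.\<close>

lemma W_fourth_le:
  "(W m n) ^ 4 \<le> 2 * (G ((m - n)\<^sup>2) (4 * (m * n * ((1 + m) * (1 + n)))))\<^sup>2 + 32 * real p ^ 2 + 1
     + real p ^ 4 * ((ind m + ind (1 + m)) * (ind n + ind (1 + n)))"
proof -
  have p4: "(W m n) ^ 4 \<le> real p ^ 4"
    using abs_chi_sum_le power_mono[of "\<bar>W m n\<bar>" "real p" 4] by (simp add: W_def)
  have sp0: "0 \<le> ind z + ind (1 + z)" for z by (simp add: ind_def)
  have sp1: "1 \<le> ind z + ind (1 + z)" if "int p dvd z \<or> int p dvd 1 + z" for z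
    using that by (auto simp: ind_def)
  have one: "x ^ 4 \<le> 1" if "\<bar>x\<bar> \<le> 1" for x :: real
    using power_mono[of "\<bar>x\<bar>" 1 4] that by simp
  have sp01: "0 \<le> real p ^ 4 * ((ind m + ind (1 + m)) * (ind n + ind (1 + n)))"
    using sp0 by simp
  let ?S = "\<lambda>z. int p dvd z \<or> int p dvd 1 + z"
  consider "?S m" "?S n" | "?S m" "\<not> ?S n" | "\<not> ?S m" "?S n" | "\<not> ?S m" "\<not> ?S n" by blast
  then show ?thesis
  proof cases
    case 1
    have "1 * 1 \<le> (ind m + ind (1 + m)) * (ind n + ind (1 + n))"
      using sp1[OF 1(1)] sp1[OF 1(2)] by (intro mult_mono) auto
    then have "real p ^ 4 * 1 \<le> real p ^ 4 * ((ind m + ind (1 + m)) * (ind n + ind (1 + n)))"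
      by (intro mult_left_mono) auto
    moreover have "0 \<le> 2 * (G ((m - n)\<^sup>2) (4 * (m * n * ((1 + m) * (1 + n)))))\<^sup>2 + 32 * real p ^ 2 + 1" by simp
    ultimately show ?thesis using p4 by linarith
  next
    case 2
    then have "(W m n) ^ 4 \<le> 1" by (intro one W_special) auto
    moreover have "0 \<le> 2 * (G ((m - n)\<^sup>2) (4 * (m * n * ((1 + m) * (1 + n)))))\<^sup>2 + 32 * real p ^ 2" by simp
    ultimately show ?thesis using sp01 by linarith
  next
    case 3
    then have "(W m n) ^ 4 \<le> 1" by (subst W_commute, intro one W_special) auto
    moreover have "0 \<le> 2 * (G ((m - n)\<^sup>2) (4 * (m * n * ((1 + m) * (1 + n)))))\<^sup>2 + 32 * real p ^ 2" by simp
    ultimately show ?thesis using sp01 by linarith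
  next
    case 4
    define g where "g = G ((m - n)\<^sup>2) (4 * (m * n * ((1 + m) * (1 + n))))"
    let ?a = "m * n" and ?b = "- (m * (1 + n) + n * (1 + m))" and ?c = "(1 + m) * (1 + n)"
    have "W m n = (\<Sum>x\<in>F. chi (x * (?a * x\<^sup>2 + ?b * x + ?c)))"
      unfolding W_def by (simp add: algebra_simps power2_eq_square)
    moreover have "?b\<^sup>2 - 4 * ?a * ?c = (m - n)\<^sup>2"
      by (simp add: algebra_simps power2_eq_square)
    moreover have "4 * ?a * ?c = 4 * (m * n * ((1 + m) * (1 + n)))"
      by (simp add: mult.assoc)
    ultimately have "\<bar>(W m n)\<^sup>2 - g\<bar> \<le> 4 * real p"
      using square_sum_chi_approx_G[of ?a ?c ?b] 4 unfolding g_def by (simp only: dvd_mult_iff) simp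
    then have "((W m n)\<^sup>2 - g)\<^sup>2 \<le> (4 * real p)\<^sup>2"
      using abs_le_square_iff[of "(W m n)\<^sup>2 - g" "4 * real p"] by simp
    moreover have "(W m n) ^ 4 \<le> 2 * g\<^sup>2 + 2 * ((W m n)\<^sup>2 - g)\<^sup>2"
    proof -
      have "2 * g\<^sup>2 + 2 * ((W m n)\<^sup>2 - g)\<^sup>2 - (W m n) ^ 4 = ((W m n)\<^sup>2 - 2 * g)\<^sup>2"
        by (simp add: power2_eq_square power4_eq_xxxx algebra_simps)
      then show ?thesis using zero_le_power2[of "(W m n)\<^sup>2 - 2 * g"] by linarith
    qed
    ultimately have "(W m n) ^ 4 \<le> 2 * g\<^sup>2 + 32 * real p ^ 2" by (simp add: power_mult_distrib)
    then show ?thesis using sp01 unfolding g_def by linarith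
  qed
qed

text \<open>The map from (m, n) to the arguments of \<open>f\<close> is a bijective shift followed
  by three quadratic maps in one variable, each at most two to one. So every point is hit at most 8
  times.\<close>

lemma sum_pairs_le:
  fixes f :: "int \<Rightarrow> int \<Rightarrow> real"
  assumes per: "\<And>A B. f (A mod int p) B = f A B" "\<And>A B. f A (B mod int p) = f A B"
    and nn: "\<And>A B. 0 \<le> f A B"
  shows "(\<Sum>m\<in>F. \<Sum>n\<in>F. f ((m - n)\<^sup>2) (4 * (m * n * ((1 + m) * (1 + n))))) \<le> 8 * (\<Sum>A\<in>F. \<Sum>B\<in>F. f A B)"
proof -
  have fc: "f A B = f A' B'" if "[A = A'] (mod int p)" "[B = B'] (mod int p)" for A A' B B'
    using that per unfolding cong_def by metis
  have "(\<Sum>m\<in>F. \<Sum>n\<in>F. f ((m - n)\<^sup>2) (4 * (m * n * ((1 + m) * (1 + n)))))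
     = (\<Sum>n\<in>F. \<Sum>m\<in>F. f ((m - n)\<^sup>2) (4 * (m * n * ((1 + m) * (1 + n)))))"
    by (rule sum.swap)
  also have "\<dots> = (\<Sum>n\<in>F. \<Sum>d\<in>F. f ((1 * d + n - n)\<^sup>2) (4 * ((1 * d + n) * n * ((1 + (1 * d + n)) * (1 + n)))))"
    by (intro sum.cong refl
        sum_affine[where f = "\<lambda>m. f ((m - n)\<^sup>2) (4 * (m * n * ((1 + m) * (1 + n))))" for n, symmetric] not_dvd_1)
       ((rule fc periodic_intros)+)
  \<comment> \<open>With \<open>d = m - n\<close> and \<open>v = n (m + 1)\<close> the second argument is \<open>4 v (v + d)\<close>.\<close>
  also have "\<dots> = (\<Sum>d\<in>F. \<Sum>n\<in>F. f (d\<^sup>2) (4 * (1 * n\<^sup>2 + (d + 1) * n + 0)\<^sup>2 + (4 * d) * (1 * n\<^sup>2 + (d + 1) * n + 0) + 0))"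
    by (subst sum.swap) (intro sum.cong refl arg_cong2[where f = f]; simp add: algebra_simps power2_eq_square)
  also have "\<dots> \<le> (\<Sum>d\<in>F. 2 * (\<Sum>v\<in>F. f (d\<^sup>2) (4 * v\<^sup>2 + (4 * d) * v + 0)))"
  proof (rule sum_mono)
    fix d
    show "(\<Sum>n\<in>F. f (d\<^sup>2) (4 * (1 * n\<^sup>2 + (d + 1) * n + 0)\<^sup>2 + (4 * d) * (1 * n\<^sup>2 + (d + 1) * n + 0) + 0))
      \<le> 2 * (\<Sum>v\<in>F. f (d\<^sup>2) (4 * v\<^sup>2 + (4 * d) * v + 0))"
      by (rule sum_comp_quadratic_le[where f = "\<lambda>v. f (d\<^sup>2) (4 * v\<^sup>2 + (4 * d) * v + 0)", OF not_dvd_1 _ nn])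
         ((rule fc periodic_intros)+)
  qed
  also have "\<dots> \<le> (\<Sum>d\<in>F. 2 * (2 * (\<Sum>B\<in>F. f (d\<^sup>2) B)))"
  proof (intro sum_mono mult_left_mono)
    fix d
    show "(\<Sum>v\<in>F. f (d\<^sup>2) (4 * v\<^sup>2 + (4 * d) * v + 0)) \<le> 2 * (\<Sum>B\<in>F. f (d\<^sup>2) B)"
      by (rule sum_comp_quadratic_le[where f = "f (d\<^sup>2)", OF not_dvd_4 per(2) nn])
  qed simp
  also have "\<dots> = 4 * (\<Sum>B\<in>F. \<Sum>d\<in>F. f (1 * d\<^sup>2 + 0 * d + 0) B)"
    by (subst sum.swap) (simp add: sum_distrib_left)
  also have "\<dots> \<le> 4 * (\<Sum>B\<in>F. 2 * (\<Sum>A\<in>F. f A B))"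
  proof (intro sum_mono mult_left_mono)
    fix B
    show "(\<Sum>d\<in>F. f (1 * d\<^sup>2 + 0 * d + 0) B) \<le> 2 * (\<Sum>A\<in>F. f A B)"
      by (rule sum_comp_quadratic_le[where f = "\<lambda>A. f A B", OF not_dvd_1 per(1) nn])
  qed simp
  also have "\<dots> = 8 * (\<Sum>A\<in>F. \<Sum>B\<in>F. f A B)"
    by (subst sum.swap) (simp add: sum_distrib_left)
  finally show ?thesis .
qed

lemma sum_W_fourth: "(\<Sum>m\<in>F. \<Sum>n\<in>F. (W m n) ^ 4) \<le> 277 * real p ^ 4"
proof -
  let ?s = "\<lambda>z. ind z + ind (1 + z)"
  have s: "(\<Sum>z\<in>F. ?s z) = 2"
    using sum_ind_affine[OF not_dvd_1, of 0] sum_ind_affine[OF not_dvd_1, of 1]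
    by (simp add: sum.distrib add.commute)
  have "(\<Sum>m\<in>F. \<Sum>n\<in>F. (W m n) ^ 4) \<le> (\<Sum>m\<in>F. \<Sum>n\<in>F.
      2 * (G ((m - n)\<^sup>2) (4 * (m * n * ((1 + m) * (1 + n)))))\<^sup>2 + 32 * real p ^ 2 + 1
     + real p ^ 4 * (?s m * ?s n))"
    by (intro sum_mono W_fourth_le)
  also have "\<dots> = 2 * (\<Sum>m\<in>F. \<Sum>n\<in>F. (G ((m - n)\<^sup>2) (4 * (m * n * ((1 + m) * (1 + n)))))\<^sup>2)
      + real p * (real p * (32 * real p ^ 2 + 1)) + real p ^ 4 * ((\<Sum>z\<in>F. ?s z) * (\<Sum>z\<in>F. ?s z))"
    by (simp only: sum.distrib sum_distrib_left[symmetric] sum_distrib_right[symmetric] sum_constant card_F)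
       (simp add: algebra_simps)
  also have "(\<Sum>m\<in>F. \<Sum>n\<in>F. (G ((m - n)\<^sup>2) (4 * (m * n * ((1 + m) * (1 + n)))))\<^sup>2)
      \<le> 8 * (\<Sum>A\<in>F. \<Sum>B\<in>F. (G A B)\<^sup>2)"
    by (rule sum_pairs_le) (simp_all add: G_periodic)
  also have "(\<Sum>A\<in>F. \<Sum>B\<in>F. (G A B)\<^sup>2) \<le> 15 * real p ^ 4"
    by (rule sum_G_square)
  finally have "(\<Sum>m\<in>F. \<Sum>n\<in>F. (W m n) ^ 4) \<le> 2 * (8 * (15 * real p ^ 4)) + real p * (real p * (32 * real p ^ 2 + 1)) + real p ^ 4 * (2 * 2)"
    unfolding s by simp
  \<comment> \<open>The coefficients add up to 240 + 32 + 1 + 4 = 277.\<close>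
  moreover have "real p ^ 2 \<le> real p ^ 4" using p_gt_2 by (intro power_increasing) auto
  ultimately show ?thesis by (simp add: algebra_simps power2_eq_square power4_eq_xxxx)
qed

lemma sum_chi_quartic_eq_W:
  "(\<Sum>a\<in>F. chi (a * (a - 1) * ((a + m) * (a + n)))) = W m n - 1"
proof -
  have "(\<Sum>a\<in>F. chi (a * (a - 1) * ((a + m) * (a + n))))
     = (\<Sum>a\<in>F - {0}. chi (a * (a - 1) * ((a + m) * (a + n))))"
    by (subst sum_F_split) (simp add: chi_0)
  also have "\<dots> = (\<Sum>a\<in>F - {0}. chi ((1 - rinv a) * ((1 + m * rinv a) * (1 + n * rinv a))))"
  proof (rule sum.cong[OF refl])
    fix a assume "a \<in> F - {0}"
    then have ua: "\<not> int p dvd a" by (rule unit_in_F)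
    \<comment> \<open>Division by the square a^4 makes the quartic a cubic in 1/a.\<close>
    have "chi (a * (a - 1) * ((a + m) * (a + n)))
       = chi ((rinv a)\<^sup>2) * chi ((rinv a)\<^sup>2) * chi (a * (a - 1) * ((a + m) * (a + n)))"
      using ua by (simp add: chi_square ind_def rinv_dvd_iff)
    also have "\<dots> = chi ((rinv a)\<^sup>2 * (rinv a)\<^sup>2 * (a * (a - 1) * ((a + m) * (a + n))))"
      by (simp only: chi_mult)
    also have "(rinv a)\<^sup>2 * (rinv a)\<^sup>2 * (a * (a - 1) * ((a + m) * (a + n)))
       = (a * rinv a) * (a * rinv a - rinv a) * ((a * rinv a + m * rinv a) * (a * rinv a + n * rinv a))"
      by (simp add: algebra_simps power2_eq_square)
    also have "chi \<dots> = chi (1 * (1 - rinv a) * ((1 + m * rinv a) * (1 + n * rinv a)))"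
      by (intro chi_cong cong_add cong_mult cong_diff cong_refl rinv ua)
    finally show "chi (a * (a - 1) * ((a + m) * (a + n))) = chi ((1 - rinv a) * ((1 + m * rinv a) * (1 + n * rinv a)))"
      by simp
  qed
  also have "\<dots> = (\<Sum>z\<in>F - {0}. chi ((1 - z) * ((1 + m * z) * (1 + n * z))))"
    by (rule sum_rinv[where f = "\<lambda>z. chi ((1 - z) * ((1 + m * z) * (1 + n * z)))"]) ((rule periodic_intros)+)
  \<comment> \<open>The value z = 0 is not the inverse of a unit; its term chi(1) accounts for the
    -1 in the statement.\<close>
  also have "\<dots> = (\<Sum>z\<in>F. chi ((1 - z) * ((1 + m * z) * (1 + n * z)))) - 1"
    by (subst sum_F_split) (simp add: chi_1)
  also have "(\<Sum>z\<in>F. chi ((1 - z) * ((1 + m * z) * (1 + n * z))))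
     = (\<Sum>w\<in>F. chi ((1 - ((-1) * w + 1)) * ((1 + m * ((-1) * w + 1)) * (1 + n * ((-1) * w + 1)))))"
    by (rule sum_affine[where f = "\<lambda>z. chi ((1 - z) * ((1 + m * z) * (1 + n * z)))", symmetric])
       ((rule periodic_intros)+, use not_dvd_1 in simp)
  also have "\<dots> = W m n"
    unfolding W_def by (intro sum.cong refl arg_cong[where f = chi]) (simp add: algebra_simps)
  finally show ?thesis .
qed

section \<open>From the cubic sums to the elliptic sums E\<close>

definition g :: "int \<Rightarrow> real" where "g a = chi (a * (a - 1))"

definition E :: "int \<Rightarrow> int \<Rightarrow> int \<Rightarrow> real" where
  "E k k' t = (\<Sum>a\<in>F. \<Sum>a'\<in>F. g a * g a' * ind (k * a - k' * a' + t))"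

lemma g_cong: "[x = y] (mod int p) \<Longrightarrow> g x = g y"
  unfolding g_def by (intro chi_cong cong_mult cong_diff cong_refl)

lemma abs_g_le: "\<bar>g a\<bar> \<le> 1"
  unfolding g_def by (rule abs_chi_le)

lemma sum_g: "(\<Sum>a\<in>F. g a) = -1"
  unfolding g_def using sum_chi_two_linear[of "-1"] not_dvd_1 by simp

text \<open>The linear condition determines a' = (k a + t) / k'; the denominators are cleared by
  chi(k'^2) = 1.\<close>

lemma E_unit:
  assumes k': "\<not> int p dvd k'"
  shows "E k k' t = (\<Sum>a\<in>F. chi (a * (a - 1) * ((k * a + t) * (k * a + (t - k')))))"
  unfolding E_def
proof (rule sum.cong[OF refl])
  fix a
  define y where "y = - (k * a + t) * rinv (- k')"
  have "(\<Sum>a'\<in>F. g a * g a' * ind (k * a - k' * a' + t)) = g a * (\<Sum>a'\<in>F. ind ((- k') * a' + (k * a + t)) * g a')"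
    by (simp add: sum_distrib_left algebra_simps)
  also have "(\<Sum>a'\<in>F. ind ((- k') * a' + (k * a + t)) * g a') = g y"
    unfolding y_def using k' by (intro sum_ind_times) (auto intro: g_cong)
  also have "g y = chi (k'\<^sup>2) * chi (y * (y - 1))"
    using k' by (simp add: g_def chi_square ind_def)
  also have "\<dots> = chi (k'\<^sup>2 * (y * (y - 1)))" by (simp only: chi_mult)
  also have "k'\<^sup>2 * (y * (y - 1)) = ((- k') * y) * ((- k') * y + k')"
    by (simp add: algebra_simps power2_eq_square)
  also have "chi \<dots> = chi ((- (k * a + t)) * (- (k * a + t) + k'))"
  proof -
    have "[- (k * a + t) * ((- k') * rinv (- k')) = - (k * a + t) * 1] (mod int p)"
      using k' by (intro cong_mult cong_refl rinv) simp
    then have "[(- k') * y = - (k * a + t)] (mod int p)"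
      unfolding y_def by (simp add: algebra_simps)
    then show ?thesis by (intro chi_cong cong_mult cong_add cong_refl)
  qed
  also have "(- (k * a + t)) * (- (k * a + t) + k') = (k * a + t) * (k * a + (t - k'))"
    by (simp add: algebra_simps)
  finally show "(\<Sum>a'\<in>F. g a * g a' * ind (k * a - k' * a' + t))
     = chi (a * (a - 1) * ((k * a + t) * (k * a + (t - k'))))"
    by (simp add: g_def chi_mult)
qed

lemma abs_sum_g_ind_le:
  "\<bar>\<Sum>a\<in>F. g a * ind (k * a + t)\<bar> \<le> 1 + real p * ind k"
proof -
  have "\<bar>\<Sum>a\<in>F. g a * ind (k * a + t)\<bar> \<le> (\<Sum>a\<in>F. \<bar>g a * ind (k * a + t)\<bar>)" by (rule sum_abs)
  also have "\<dots> \<le> (\<Sum>a\<in>F. ind (k * a + t))"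
    using abs_g_le by (intro sum_mono) (simp add: ind_def)
  also have "\<dots> \<le> 1 + real p * ind k"
  proof (cases "int p dvd k")
    case True
    have "(\<Sum>a\<in>F. ind (k * a + t)) \<le> real p"
      using sum_bounded_above[of F "\<lambda>a. ind (k * a + t)" 1] by (simp add: ind_def)
    then show ?thesis using True by (simp add: ind_def)
  next
    case False
    then show ?thesis using sum_ind_affine[of k t] by (simp add: ind_def)
  qed
  finally show ?thesis .
qed

text \<open>The condition then involves only one of the two variables, so the sum factors and the
  free factor is the sum of \<open>g\<close>, namely -1.\<close>

lemma E_degenerate:
  assumes "int p dvd k \<or> int p dvd k'"
  shows "\<bar>E k k' t\<bar> \<le> 1 + real p * (ind k * ind k')"
  using assms
proof
  assume k: "int p dvd k"
  have "ind (k * a - k' * a' + t) = ind ((- k') * a' + t)" for a a'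
    using k by (intro ind_cong) (simp add: cong_iff_dvd_diff)
  then have "E k k' t = (\<Sum>a\<in>F. g a) * (\<Sum>a'\<in>F. g a' * ind ((- k') * a' + t))"
    unfolding E_def by (simp add: sum_product mult.assoc)
  then show ?thesis using abs_sum_g_ind_le[of "- k'" t] k by (simp add: sum_g ind_def)
next
  assume k': "int p dvd k'"
  have "ind (k * a - k' * a' + t) = ind (k * a + t)" for a a'
    using k' by (intro ind_cong) (simp add: cong_iff_dvd_diff)
  then have "E k k' t = (\<Sum>a\<in>F. g a * ind (k * a + t)) * (\<Sum>a'\<in>F. g a')"
    unfolding E_def sum_product by (simp add: mult_ac)
  then show ?thesis using abs_sum_g_ind_le[of k t] k' by (simp add: sum_g ind_def)
qed

text \<open>For fixed \<open>k\<close> the pair (t, t - k') stays within all pairs of residues.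
  Writing such a pair as (k m, k n) extracts the square k^2 from the quartic and leaves
  \<open>W m n - 1\<close>.\<close>

lemma sum_E_fourth_unit:
  assumes k: "\<not> int p dvd k"
  shows "(\<Sum>k'\<in>F - {0}. \<Sum>t\<in>F. (E k k' t) ^ 4) \<le> 2224 * real p ^ 4"
proof -
  define Q where "Q t s = (\<Sum>a\<in>F. chi (a * (a - 1) * ((k * a + t) * (k * a + s)))) ^ 4" for t s
  have Qc: "Q t s = Q t' s'" if "[t = t'] (mod int p)" "[s = s'] (mod int p)" for t s t' s'
    unfolding Q_def
    by (intro arg_cong[where f = "\<lambda>x. x ^ 4"] sum.cong refl chi_cong cong_mult cong_add cong_refl that)
  have "(\<Sum>k'\<in>F - {0}. \<Sum>t\<in>F. (E k k' t) ^ 4) = (\<Sum>k'\<in>F - {0}. \<Sum>t\<in>F. Q t (t - k'))"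
    unfolding Q_def using unit_in_F by (intro sum.cong refl) (simp add: E_unit)
  also have "\<dots> \<le> (\<Sum>k'\<in>F. \<Sum>t\<in>F. Q t (t - k'))"
    by (intro sum_mono2 sum_nonneg) (auto simp: Q_def)
  also have "\<dots> = (\<Sum>t\<in>F. \<Sum>k'\<in>F. Q t ((-1) * k' + t))"
    by (subst sum.swap) simp
  also have "\<dots> = (\<Sum>t\<in>F. \<Sum>s\<in>F. Q t s)"
    using not_dvd_1 by (intro sum.cong refl sum_affine Qc) auto
  also have "\<dots> = (\<Sum>m\<in>F. \<Sum>s\<in>F. Q (k * m + 0) s)"
    by (rule sum_affine[where f = "\<lambda>t. \<Sum>s\<in>F. Q t s", OF _ k, symmetric]) (intro sum.cong refl Qc, auto)
  also have "\<dots> = (\<Sum>m\<in>F. \<Sum>n\<in>F. Q (k * m + 0) (k * n + 0))"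
    by (intro sum.cong refl sum_affine[where f = "Q (k * m + 0)" for m, OF _ k, symmetric] Qc) auto
  also have "\<dots> = (\<Sum>m\<in>F. \<Sum>n\<in>F. (W m n - 1) ^ 4)"
  proof (intro sum.cong refl)
    fix m n
    have "chi (a * (a - 1) * ((k * a + (k * m + 0)) * (k * a + (k * n + 0)))) = chi (a * (a - 1) * ((a + m) * (a + n)))" for a
    proof -
      have "a * (a - 1) * ((k * a + (k * m + 0)) * (k * a + (k * n + 0))) = k\<^sup>2 * (a * (a - 1) * ((a + m) * (a + n)))"
        by (simp add: algebra_simps power2_eq_square)
      then show ?thesis using k by (simp only: chi_mult[of "k\<^sup>2"] chi_square) (simp add: ind_def)
    qed
    then show "Q (k * m + 0) (k * n + 0) = (W m n - 1) ^ 4"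
      unfolding Q_def by (simp only: sum_chi_quartic_eq_W)
  qed
  also have "\<dots> \<le> (\<Sum>m\<in>F. \<Sum>n\<in>F. 8 * (W m n) ^ 4 + 8)"
  proof (intro sum_mono)
    fix m n
    have sq: "(x - y)\<^sup>2 \<le> 2 * x\<^sup>2 + 2 * y\<^sup>2" for x y :: real
      using zero_le_power2[of "x + y"] by (simp add: power2_eq_square algebra_simps)
    have sq': "(x + y)\<^sup>2 \<le> 2 * x\<^sup>2 + 2 * y\<^sup>2" for x y :: real
      using zero_le_power2[of "x - y"] by (simp add: power2_eq_square algebra_simps)
    have "(W m n - 1) ^ 4 = ((W m n - 1)\<^sup>2)\<^sup>2" by simp
    also have "\<dots> \<le> (2 * (W m n)\<^sup>2 + 2 * 1\<^sup>2)\<^sup>2" by (intro power_mono sq) simp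
    also have "\<dots> \<le> 2 * (2 * (W m n)\<^sup>2)\<^sup>2 + 2 * (2 * 1\<^sup>2)\<^sup>2" by (rule sq')
    finally show "(W m n - 1) ^ 4 \<le> 8 * (W m n) ^ 4 + 8" by (simp add: power_mult_distrib)
  qed
  also have "\<dots> = 8 * (\<Sum>m\<in>F. \<Sum>n\<in>F. (W m n) ^ 4) + 8 * real p ^ 2"
    by (simp add: sum.distrib power2_eq_square flip: sum_distrib_left)
  also have "\<dots> \<le> 8 * (277 * real p ^ 4) + 8 * real p ^ 4"
    using sum_W_fourth p_gt_2 by (intro add_mono mult_left_mono power_increasing) auto
  finally show ?thesis by simp
qed

lemma sum_E_fourth: "(\<Sum>k\<in>F. \<Sum>k'\<in>F. \<Sum>t\<in>F. (E k k' t) ^ 4) \<le> 2242 * real p ^ 5"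
proof -
  let ?p = "real p"
  have p1: "1 \<le> ?p" using p_gt_2 by simp
  have pw: "(x :: real) ^ 4 \<le> y ^ 4" if "\<bar>x\<bar> \<le> y" for x y
    using power_mono[of "\<bar>x\<bar>" y 4] that by simp
  have z: "(\<Sum>k'\<in>F. \<Sum>t\<in>F. (E 0 k' t) ^ 4) \<le> 17 * ?p ^ 5"
  proof -
    \<comment> \<open>At k = k' = 0 the sum may be of size p for all p values of \<open>t\<close>,
      hence 16 p^5. The remaining terms are at most 1 each.\<close>
    have "(\<Sum>k'\<in>F. \<Sum>t\<in>F. (E 0 k' t) ^ 4) \<le> (\<Sum>k'\<in>F. \<Sum>t\<in>F. if k' = 0 then 16 * ?p ^ 4 else 1)"
    proof (intro sum_mono)
      fix k' t assume k': "k' \<in> F"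
      have e: "\<bar>E 0 k' t\<bar> \<le> 1 + ?p * ind k'" using E_degenerate[of 0 k' t] by (simp add: ind_def)
      show "(E 0 k' t) ^ 4 \<le> (if k' = 0 then 16 * ?p ^ 4 else 1)"
      proof (cases "k' = 0")
        case True
        then have "\<bar>E 0 k' t\<bar> \<le> 2 * ?p" using e p1 by (simp add: ind_def)
        then show ?thesis using pw[of "E 0 k' t" "2 * ?p"] True by (simp add: power_mult_distrib)
      next
        case False
        then have "\<bar>E 0 k' t\<bar> \<le> 1" using e dvd_F_iff[OF k'] by (simp add: ind_def)
        then show ?thesis using pw[of "E 0 k' t" 1] False by simp
      qed
    qed
    also have "\<dots> \<le> (\<Sum>k'\<in>F. (if k' = 0 then 16 * ?p ^ 5 else 0) + ?p)"
      by (intro sum_mono) (simp add: eval_nat_numeral)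
    also have "\<dots> = 16 * ?p ^ 5 + ?p ^ 2"
      using p_gt_2 by (simp add: sum.distrib power2_eq_square)
    also have "?p ^ 2 \<le> ?p ^ 5" using p1 by (intro power_increasing) auto
    finally show ?thesis by simp
  qed
  have u: "(\<Sum>k'\<in>F. \<Sum>t\<in>F. (E k k' t) ^ 4) \<le> 2225 * ?p ^ 4" if "k \<in> F - {0}" for k
  proof -
    note uk = unit_in_F[OF that]
    have "(\<Sum>t\<in>F. (E k 0 t) ^ 4) \<le> (\<Sum>t\<in>F. 1)"
    proof (rule sum_mono)
      fix t
      show "(E k 0 t) ^ 4 \<le> 1"
        using E_degenerate[of k 0 t] pw[of "E k 0 t" 1] uk by (simp add: ind_def)
    qed
    also have "\<dots> \<le> ?p ^ 4" using p1 power_increasing[of 1 4 ?p] by simp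
    finally show ?thesis using sum_E_fourth_unit[OF uk] by (subst sum_F_split) simp
  qed
  have "(\<Sum>k\<in>F. \<Sum>k'\<in>F. \<Sum>t\<in>F. (E k k' t) ^ 4) \<le> 17 * ?p ^ 5 + (\<Sum>k\<in>F - {0}. 2225 * ?p ^ 4)"
    by (subst sum_F_split) (intro add_mono z sum_mono u)
  also have "(\<Sum>k\<in>F - {0}. 2225 * ?p ^ 4) \<le> 2225 * ?p ^ 5"
    using card_units by (simp add: eval_nat_numeral algebra_simps)
  finally show ?thesis by simp
qed


section \<open>Fourier analysis of \<open>T\<close>\<close>

definition e :: "int \<Rightarrow> complex" where "e x = cis (2 * pi * real_of_int x / real p)"

lemma e_add: "e (x + y) = e x * e y"
  by (simp add: e_def cis_mult add_divide_distrib distrib_left)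

lemma e_0: "e 0 = 1"
  by (simp add: e_def)

lemma cnj_e: "cnj (e x) = e (- x)"
  by (simp add: e_def cis_cnj)

lemma e_multiple: "e (int p * x) = 1"
proof -
  have "2 * pi * real_of_int (int p * x) / real p = 2 * pi * real_of_int x"
    using p_gt_2 by simp
  then show ?thesis unfolding e_def by (simp only: cis_multiple_2pi Ints_of_int)
qed

lemma e_cong: assumes "[x = y] (mod int p)" shows "e x = e y"
proof -
  obtain z where "x = y + int p * z"
    using assms by (metis cong_iff_lin cong_sym mult.commute)
  then show ?thesis by (simp add: e_add e_multiple)
qed

lemma e_1_neq: "e 1 \<noteq> 1"
proof
  assume "e 1 = 1"
  then have "cos (2 * pi / real p) = 1"
    by (metis Re_complex_of_real cis.sel(1) e_def mult.right_neutral of_int_1 of_real_1)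
  then obtain n :: int where n: "2 * pi / real p = of_int n * 2 * pi"
    using cos_one_2pi_int by blast
  then have "1 = real_of_int n * real p" using p_gt_2 by (simp add: field_simps)
  then have "1 = n * int p" by (metis of_int_eq_1_iff of_int_mult of_int_of_nat_eq)
  then show False using not_dvd_1 by (metis dvd_triv_right)
qed

text \<open>The shift k to k + 1 preserves the complete sum and multiplies it by \<open>e 1\<close>,
  which is not 1; the general nonzero \<open>x\<close> follows by rescaling
  \<open>k\<close>.\<close>

lemma sum_e: "(\<Sum>k\<in>F. e (k * x)) = of_real (real p * ind x)"
proof (cases "int p dvd x")
  case True
  have "e (k * x) = e 0" for k using True by (intro e_cong) (simp add: cong_0_iff)
  then show ?thesis using True by (simp add: e_0 ind_def)
next
  case False
  have per: "e (z mod int p) = e z" for z by (rule e_cong) simp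
  have "(\<Sum>k\<in>F. e (1 * k + 1)) = (\<Sum>k\<in>F. e k)"
    by (rule sum_affine[where f = e, OF per not_dvd_1])
  then have "(\<Sum>k\<in>F. e k) * (e 1 - 1) = 0"
    by (simp add: e_add algebra_simps flip: sum_distrib_left sum_distrib_right)
  then have "(\<Sum>k\<in>F. e k) = 0" using e_1_neq by simp
  moreover have "(\<Sum>k\<in>F. e (x * k + 0)) = (\<Sum>k\<in>F. e k)"
    by (rule sum_affine[where f = e, OF per False])
  ultimately show ?thesis using False by (simp add: ind_def mult.commute)
qed

text \<open>Summing over \<open>k\<close> first, orthogonality leaves only the diagonal j =
  j'.\<close>

lemma parseval:
  "(\<Sum>k\<in>F. (\<Sum>j\<in>F. f j * e (j * k)) * cnj (\<Sum>j\<in>F. h j * e (j * k)))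
    = of_nat p * (\<Sum>j\<in>F. f j * cnj (h j))"
proof -
  have "(\<Sum>k\<in>F. (\<Sum>j\<in>F. f j * e (j * k)) * cnj (\<Sum>j\<in>F. h j * e (j * k)))
     = (\<Sum>k\<in>F. \<Sum>j\<in>F. \<Sum>j'\<in>F. f j * cnj (h j') * e (k * (j - j')))"
  proof (rule sum.cong[OF refl])
    fix k
    have "e (k * (j - j')) = e (j * k) * e (- (j' * k))" for j j'
      by (simp add: algebra_simps flip: e_add)
    then show "(\<Sum>j\<in>F. f j * e (j * k)) * cnj (\<Sum>j\<in>F. h j * e (j * k))
      = (\<Sum>j\<in>F. \<Sum>j'\<in>F. f j * cnj (h j') * e (k * (j - j')))"
      by (simp add: cnj_e sum_product mult_ac)
  qed
  also have "\<dots> = (\<Sum>j\<in>F. \<Sum>k\<in>F. \<Sum>j'\<in>F. f j * cnj (h j') * e (k * (j - j')))"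
    by (rule sum.swap)
  also have "\<dots> = (\<Sum>j\<in>F. \<Sum>j'\<in>F. \<Sum>k\<in>F. f j * cnj (h j') * e (k * (j - j')))"
    by (intro sum.cong refl sum.swap)
  also have "\<dots> = (\<Sum>j\<in>F. \<Sum>j'\<in>F. if j' = j then of_nat p * (f j * cnj (h j)) else 0)"
  proof (intro sum.cong refl)
    fix j j' assume j: "j \<in> F" "j' \<in> F"
    have "ind (j - j') = (if j' = j then 1 else 0)"
      using cong_in_F_eq[OF j] by (auto simp: ind_def cong_iff_dvd_diff)
    then show "(\<Sum>k\<in>F. f j * cnj (h j') * e (k * (j - j'))) = (if j' = j then of_nat p * (f j * cnj (h j)) else 0)"
      by (simp add: sum_e flip: sum_distrib_left)
  qed
  also have "\<dots> = of_nat p * (\<Sum>j\<in>F. f j * cnj (h j))"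
    by (simp add: sum_distrib_left)
  finally show ?thesis .
qed

section \<open>Fourier transforms of the rows and the Gram entries\<close>

definition ghat :: "int \<Rightarrow> complex" where "ghat m = (\<Sum>a\<in>F. of_real (g a) * e (a * m))"

lemma ghat_cong: "[x = y] (mod int p) \<Longrightarrow> ghat x = ghat y"
  unfolding ghat_def by (intro sum.cong refl arg_cong2[where f = "(*)"] e_cong cong_mult cong_refl)

lemma cnj_ghat: "cnj (ghat m) = ghat (- m)"
  by (simp add: ghat_def cnj_e)

definition T :: "int \<Rightarrow> int \<Rightarrow> real" where "T i j = (\<Sum>x\<in>F. g (i * x - j) * g ((i + 1) * x - j))"

lemma T_entry_eq: "real_of_int (T_entry p i j) = T i j"
  unfolding T_entry_def T_def of_int_sum g_def
  by (intro sum.cong refl) (simp only: chi_def[symmetric] chi_mult[symmetric], simp add: algebra_simps)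

text \<open>Take a = i x - j and b = (i + 1) x - j as variables. Then j = i b - (i + 1) a, so the
  double sum splits into two transforms of \<open>g\<close>.\<close>

lemma T_fourier: "(\<Sum>j\<in>F. of_real (T i j) * e (j * k)) = ghat (i * k) * ghat (- (i + 1) * k)"
proof -
  have "(\<Sum>j\<in>F. of_real (T i j) * e (j * k))
     = (\<Sum>x\<in>F. \<Sum>j\<in>F. of_real (g (i * x - j) * g ((i + 1) * x - j)) * e (j * k))"
    by (subst sum.swap) (simp add: T_def sum_distrib_right)
  also have "\<dots> = (\<Sum>x\<in>F. \<Sum>a\<in>F. of_real (g (i * x - ((-1) * a + i * x)) * g ((i + 1) * x - ((-1) * a + i * x)))
       * e (((-1) * a + i * x) * k))"
    using not_dvd_1
    by (intro sum.cong refl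
      sum_affine[where f = "\<lambda>j. of_real (g (i * x - j) * g ((i + 1) * x - j)) * e (j * k)" for x, symmetric]
      arg_cong2[where f = "(*)"] arg_cong[where f = of_real] g_cong e_cong cong_mult cong_diff cong_refl) auto
  also have "\<dots> = (\<Sum>a\<in>F. \<Sum>x\<in>F. of_real (g a * g (x + a)) * e ((i * x - a) * k))"
    by (subst sum.swap) (simp add: algebra_simps)
  also have "\<dots> = (\<Sum>a\<in>F. \<Sum>b\<in>F. of_real (g a * g ((1 * b + (- a)) + a)) * e ((i * (1 * b + (- a)) - a) * k))"
    by (intro sum.cong refl not_dvd_1
      sum_affine[where f = "\<lambda>x. of_real (g a * g (x + a)) * e ((i * x - a) * k)" for a, symmetric]
      arg_cong2[where f = "(*)"] arg_cong[where f = of_real] g_cong e_cong cong_mult cong_diff cong_add cong_refl) auto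
  also have "\<dots> = (\<Sum>a\<in>F. \<Sum>b\<in>F. (of_real (g a) * e (a * (- (i + 1) * k))) * (of_real (g b) * e (b * (i * k))))"
  proof (intro sum.cong refl)
    fix a b
    have "e ((i * (1 * b + (- a)) - a) * k) = e (a * (- (i + 1) * k)) * e (b * (i * k))"
      unfolding e_add[symmetric] by (rule arg_cong[where f = e]) (simp add: algebra_simps)
    then show "of_real (g a * g ((1 * b + (- a)) + a)) * e ((i * (1 * b + (- a)) - a) * k)
      = (of_real (g a) * e (a * (- (i + 1) * k))) * (of_real (g b) * e (b * (i * k)))"
      by simp
  qed
  also have "\<dots> = ghat (- (i + 1) * k) * ghat (i * k)"
    by (simp only: ghat_def sum_product)
  finally show ?thesis by (simp add: mult.commute)
qed

text \<open>The four frequencies add up to 0, and (c, \<open>\<alpha>\<close>,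
  \<open>\<gamma>\<close>) parametrises the whole hyperplane of such quadruples. The slice c = 1
  gives the Gram entries.\<close>

definition H :: "int \<Rightarrow> int \<Rightarrow> int \<Rightarrow> complex" where
  "H c \<alpha> \<gamma> = (\<Sum>k\<in>F. ghat (\<alpha> * k) * ghat (- (\<alpha> + c) * k) * ghat (- \<gamma> * k) * ghat ((\<gamma> + c) * k))"

text \<open>Parseval for two rows; conjugation negates the frequencies because \<open>g\<close> is
  real.\<close>

lemma gram_T: "of_nat p * complex_of_real (\<Sum>j\<in>F. T i j * T i' j) = H 1 i i'"
proof -
  have "of_nat p * complex_of_real (\<Sum>j\<in>F. T i j * T i' j)
     = of_nat p * (\<Sum>j\<in>F. of_real (T i j) * cnj (of_real (T i' j)))" by simp
  also have "\<dots> = (\<Sum>k\<in>F. ghat (i * k) * ghat (- (i + 1) * k) * cnj (ghat (i' * k) * ghat (- (i' + 1) * k)))"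
    unfolding parseval[symmetric] T_fourier ..
  also have "\<dots> = H 1 i i'"
  proof -
    have "cnj (ghat (- (i' + 1) * k)) = ghat ((i' + 1) * k)" for k
      unfolding cnj_ghat by (rule arg_cong[where f = ghat]) (simp add: algebra_simps)
    then show ?thesis unfolding H_def by (simp add: cnj_ghat mult.assoc)
  qed
  finally show ?thesis .
qed

lemma H_scale:
  assumes c: "\<not> int p dvd c"
  shows "H c (c * i + 0) (c * i' + 0) = H 1 i i'"
proof -
  have "H c (c * i + 0) (c * i' + 0) = (\<Sum>k\<in>F. ghat (i * (c * k + 0)) * ghat (- (i + 1) * (c * k + 0))
      * ghat (- i' * (c * k + 0)) * ghat ((i' + 1) * (c * k + 0)))"
    unfolding H_def
    by (simp add: algebra_simps)
  also have "\<dots> = H 1 i i'" unfolding H_def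
    by (intro sum_affine[where f = "\<lambda>k. ghat (i * k) * ghat (- (i + 1) * k) * ghat (- i' * k) * ghat ((i' + 1) * k)"]
      c arg_cong2[where f = "(*)"] ghat_cong cong_mult cong_refl cong_mod_self)
  finally show ?thesis .
qed

lemma H_cong:
  assumes "[\<alpha> = \<alpha>'] (mod int p)" "[\<gamma> = \<gamma>'] (mod int p)"
  shows "H c \<alpha> \<gamma> = H c \<alpha>' \<gamma>'"
  unfolding H_def
  by (intro sum.cong refl arg_cong2[where f = "(*)"] ghat_cong cong_mult cong_add cong_uminus cong_refl assms)

text \<open>Replacing \<open>k\<close> by c k shows that all p - 1 slices with c \<noteq> 0 have the
  same sum; the slice c = 0 is added since its terms are nonnegative.\<close>

lemma sum_H_scale: "(real p - 1) * (\<Sum>i\<in>F. \<Sum>i'\<in>F. (norm (H 1 i i'))\<^sup>2)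
    \<le> (\<Sum>c\<in>F. \<Sum>\<alpha>\<in>F. \<Sum>\<gamma>\<in>F. (norm (H c \<alpha> \<gamma>))\<^sup>2)"
proof -
  have "(real p - 1) * (\<Sum>i\<in>F. \<Sum>i'\<in>F. (norm (H 1 i i'))\<^sup>2)
     = (\<Sum>c\<in>F - {0}. \<Sum>i\<in>F. \<Sum>i'\<in>F. (norm (H 1 i i'))\<^sup>2)"
    using card_units by simp
  also have "\<dots> = (\<Sum>c\<in>F - {0}. \<Sum>\<alpha>\<in>F. \<Sum>\<gamma>\<in>F. (norm (H c \<alpha> \<gamma>))\<^sup>2)"
  proof (rule sum.cong[OF refl])
    fix c assume "c \<in> F - {0}"
    then have c: "\<not> int p dvd c" by (rule unit_in_F)
    have "(\<Sum>i\<in>F. \<Sum>i'\<in>F. (norm (H 1 i i'))\<^sup>2) = (\<Sum>i\<in>F. \<Sum>i'\<in>F. (norm (H c (c * i + 0) (c * i' + 0)))\<^sup>2)"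
      using H_scale[OF c] by simp
    also have "\<dots> = (\<Sum>i\<in>F. \<Sum>\<gamma>\<in>F. (norm (H c (c * i + 0) \<gamma>))\<^sup>2)"
      by (intro sum.cong refl sum_affine[where f = "\<lambda>\<gamma>. (norm (H c (c * i + 0) \<gamma>))\<^sup>2" for i] c
        arg_cong[where f = "\<lambda>z. (norm z)\<^sup>2"] H_cong cong_refl cong_mod_self)
    also have "\<dots> = (\<Sum>\<alpha>\<in>F. \<Sum>\<gamma>\<in>F. (norm (H c \<alpha> \<gamma>))\<^sup>2)"
      by (rule sum_affine[where f = "\<lambda>\<alpha>. \<Sum>\<gamma>\<in>F. (norm (H c \<alpha> \<gamma>))\<^sup>2", OF _ c])
         (intro sum.cong refl arg_cong[where f = "\<lambda>z. (norm z)\<^sup>2"] H_cong cong_refl cong_mod_self)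
    finally show "(\<Sum>i\<in>F. \<Sum>i'\<in>F. (norm (H 1 i i'))\<^sup>2) = (\<Sum>\<alpha>\<in>F. \<Sum>\<gamma>\<in>F. (norm (H c \<alpha> \<gamma>))\<^sup>2)" .
  qed
  also have "\<dots> \<le> (\<Sum>c\<in>F. \<Sum>\<alpha>\<in>F. \<Sum>\<gamma>\<in>F. (norm (H c \<alpha> \<gamma>))\<^sup>2)"
    by (intro sum_mono2 sum_nonneg) auto
  finally show ?thesis .
qed

text \<open>Open both transforms; the sum over \<open>\<alpha>\<close> enforces the linear condition
  that defines \<open>E\<close>.\<close>

lemma fourier_ghat_product:
  "(\<Sum>\<alpha>\<in>F. ghat (\<alpha> * k) * cnj (ghat (\<alpha> * k')) * e (\<alpha> * s)) = of_real (real p * E k k' s)"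
proof -
  have "(\<Sum>\<alpha>\<in>F. ghat (\<alpha> * k) * cnj (ghat (\<alpha> * k')) * e (\<alpha> * s))
     = (\<Sum>\<alpha>\<in>F. \<Sum>a\<in>F. \<Sum>a'\<in>F. of_real (g a * g a') * e (\<alpha> * (k * a - k' * a' + s)))"
  proof (rule sum.cong[OF refl])
    fix \<alpha>
    have "e (\<alpha> * (k * a - k' * a' + s)) = e (a * (\<alpha> * k)) * e (a' * - (\<alpha> * k')) * e (\<alpha> * s)" for a a'
      unfolding e_add[symmetric] by (rule arg_cong[where f = e]) (simp add: algebra_simps)
    then show "ghat (\<alpha> * k) * cnj (ghat (\<alpha> * k')) * e (\<alpha> * s)
      = (\<Sum>a\<in>F. \<Sum>a'\<in>F. of_real (g a * g a') * e (\<alpha> * (k * a - k' * a' + s)))"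
      unfolding cnj_ghat unfolding ghat_def unfolding sum_product unfolding sum_distrib_right
      by (simp add: mult_ac)
  qed
  also have "\<dots> = (\<Sum>a\<in>F. \<Sum>\<alpha>\<in>F. \<Sum>a'\<in>F. of_real (g a * g a') * e (\<alpha> * (k * a - k' * a' + s)))"
    by (rule sum.swap)
  also have "\<dots> = (\<Sum>a\<in>F. \<Sum>a'\<in>F. \<Sum>\<alpha>\<in>F. of_real (g a * g a') * e (\<alpha> * (k * a - k' * a' + s)))"
    by (intro sum.cong refl sum.swap)
  also have "\<dots> = of_real (real p * E k k' s)"
    unfolding E_def by (simp only: sum_distrib_left[symmetric] sum_e) (simp add: sum_distrib_left mult_ac)
  finally show ?thesis .
qed

text \<open>The first inner sum is the convolution of \<open>\<psi>\<close> with itself at -c, so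
  its transform is the square of \<open>h\<close> at the negated argument. The second inner sum is
  its conjugate by \<open>herm\<close>, so Parseval yields the fourth power.\<close>

lemma sum_convolution:
  fixes \<psi> :: "int \<Rightarrow> complex" and h :: "int \<Rightarrow> real"
  assumes per: "\<And>x y. [x = y] (mod int p) \<Longrightarrow> \<psi> x = \<psi> y"
    and herm: "\<And>x. \<psi> (- x) = cnj (\<psi> x)"
    and four: "\<And>s. (\<Sum>\<alpha>\<in>F. \<psi> \<alpha> * e (\<alpha> * s)) = of_real (h s)"
    and hper: "\<And>s. h (s mod int p) = h s"
  shows "of_nat p * (\<Sum>c\<in>F. (\<Sum>\<alpha>\<in>F. \<psi> \<alpha> * \<psi> (- (\<alpha> + c))) * (\<Sum>\<gamma>\<in>F. \<psi> (- \<gamma>) * \<psi> (\<gamma> + c)))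
     = of_real (\<Sum>s\<in>F. (h s) ^ 4)"
proof -
  define C where "C c = (\<Sum>\<alpha>\<in>F. \<psi> \<alpha> * \<psi> (- (\<alpha> + c)))" for c
  have cn: "(\<Sum>\<gamma>\<in>F. \<psi> (- \<gamma>) * \<psi> (\<gamma> + c)) = cnj (C c)" for c
    unfolding C_def cnj_sum complex_cnj_mult by (simp only: herm[symmetric] minus_minus)
  have ft: "(\<Sum>c\<in>F. C c * e (c * t)) = of_real ((h (- t))\<^sup>2)" for t
  proof -
    have "(\<Sum>c\<in>F. C c * e (c * t)) = (\<Sum>\<alpha>\<in>F. \<Sum>c\<in>F. \<psi> \<alpha> * \<psi> (- (\<alpha> + c)) * e (c * t))"
      by (subst sum.swap) (simp add: C_def sum_distrib_right)
    also have "\<dots> = (\<Sum>\<alpha>\<in>F. \<Sum>\<beta>\<in>F. \<psi> \<alpha> * \<psi> (- (\<alpha> + ((-1) * \<beta> + (- \<alpha>)))) * e (((-1) * \<beta> + (- \<alpha>)) * t))"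
      using not_dvd_1
      by (intro sum.cong refl
        sum_affine[where f = "\<lambda>c. \<psi> \<alpha> * \<psi> (- (\<alpha> + c)) * e (c * t)" for \<alpha>, symmetric]
        arg_cong2[where f = "(*)"] per e_cong cong_mult cong_add cong_uminus cong_refl cong_mod_self) simp
    also have "\<dots> = (\<Sum>\<alpha>\<in>F. \<Sum>\<beta>\<in>F. (\<psi> \<alpha> * e (\<alpha> * - t)) * (\<psi> \<beta> * e (\<beta> * - t)))"
    proof (intro sum.cong refl)
      fix \<alpha> \<beta>
      have "e (((-1) * \<beta> + (- \<alpha>)) * t) = e (\<alpha> * - t) * e (\<beta> * - t)"
        unfolding e_add[symmetric] by (rule arg_cong[where f = e]) (simp add: algebra_simps)
      then show "\<psi> \<alpha> * \<psi> (- (\<alpha> + ((-1) * \<beta> + (- \<alpha>)))) * e (((-1) * \<beta> + (- \<alpha>)) * t)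
         = (\<psi> \<alpha> * e (\<alpha> * - t)) * (\<psi> \<beta> * e (\<beta> * - t))"
        by simp
    qed
    also have "\<dots> = (\<Sum>\<alpha>\<in>F. \<psi> \<alpha> * e (\<alpha> * - t)) * (\<Sum>\<beta>\<in>F. \<psi> \<beta> * e (\<beta> * - t))"
      by (simp only: sum_product)
    finally show ?thesis by (simp only: four of_real_power power2_eq_square of_real_mult)
  qed
  have "of_nat p * (\<Sum>c\<in>F. C c * cnj (C c)) = (\<Sum>t\<in>F. of_real ((h (- t))\<^sup>2) * cnj (of_real ((h (- t))\<^sup>2)))"
    unfolding parseval[symmetric] ft ..
  also have "\<dots> = of_real (\<Sum>t\<in>F. (h ((-1) * t + 0)) ^ 4)"
    by (simp flip: of_real_mult of_real_power power_add)
  also have "(\<Sum>t\<in>F. (h ((-1) * t + 0)) ^ 4) = (\<Sum>s\<in>F. (h s) ^ 4)"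
    using not_dvd_1 by (intro sum_affine[where f = "\<lambda>s. (h s) ^ 4"]) (simp_all add: hper)
  finally show ?thesis unfolding cn C_def .
qed

lemma E_periodic: "E k k' (t mod int p) = E k k' t"
  unfolding E_def
  by (intro sum.cong refl arg_cong2[where f = "(*)"] ind_cong cong_add cong_refl cong_mod_self)

text \<open>Expanding the squared norm of \<open>H\<close> gives a double sum over \<open>k\<close>,
  \<open>k'\<close>. For fixed \<open>k\<close>, \<open>k'\<close> the sum over the hyperplane is
  the one in \<open>sum_convolution\<close>, with transform p E. Of the resulting p^4 one factor is
  spent on Parseval.\<close>

lemma sum_H_square:
  "(\<Sum>c\<in>F. \<Sum>\<alpha>\<in>F. \<Sum>\<gamma>\<in>F. (norm (H c \<alpha> \<gamma>))\<^sup>2)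
    = real p ^ 3 * (\<Sum>k\<in>F. \<Sum>k'\<in>F. \<Sum>t\<in>F. (E k k' t) ^ 4)"
proof -
  define \<psi> where "\<psi> k k' x = ghat (x * k) * cnj (ghat (x * k'))" for k k' x
  let ?Z = "\<lambda>k k' c \<alpha> \<gamma>. (\<psi> k k' \<alpha> * \<psi> k k' (- (\<alpha> + c))) * (\<psi> k k' (- \<gamma>) * \<psi> k k' (\<gamma> + c))"
  have Z: "of_real ((norm (H c \<alpha> \<gamma>))\<^sup>2) = (\<Sum>k\<in>F. \<Sum>k'\<in>F. ?Z k k' c \<alpha> \<gamma>)" for c \<alpha> \<gamma>
    unfolding complex_norm_square H_def \<psi>_def by (simp add: sum_product mult_ac)
  have inner: "of_nat p * (\<Sum>c\<in>F. \<Sum>\<alpha>\<in>F. \<Sum>\<gamma>\<in>F. ?Z k k' c \<alpha> \<gamma>)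
      = of_real (\<Sum>t\<in>F. (real p * E k k' t) ^ 4)" for k k'
  proof -
    have "(\<Sum>c\<in>F. \<Sum>\<alpha>\<in>F. \<Sum>\<gamma>\<in>F. ?Z k k' c \<alpha> \<gamma>)
      = (\<Sum>c\<in>F. (\<Sum>\<alpha>\<in>F. \<psi> k k' \<alpha> * \<psi> k k' (- (\<alpha> + c))) * (\<Sum>\<gamma>\<in>F. \<psi> k k' (- \<gamma>) * \<psi> k k' (\<gamma> + c)))"
      by (simp only: sum_product)
    moreover have "of_nat p * \<dots> = of_real (\<Sum>t\<in>F. (real p * E k k' t) ^ 4)"
    proof (rule sum_convolution)
      show "\<psi> k k' x = \<psi> k k' y" if "[x = y] (mod int p)" for x y
        unfolding \<psi>_def
        by (intro arg_cong2[where f = "(*)"] arg_cong[where f = cnj] ghat_cong cong_mult cong_refl that)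
      show "\<psi> k k' (- x) = cnj (\<psi> k k' x)" for x
        unfolding \<psi>_def by (simp add: cnj_ghat)
      show "(\<Sum>\<alpha>\<in>F. \<psi> k k' \<alpha> * e (\<alpha> * s)) = of_real (real p * E k k' s)" for s
        unfolding \<psi>_def by (rule fourier_ghat_product)
    qed (simp add: E_periodic)
    ultimately show ?thesis by simp
  qed
  have "complex_of_real (real p * (\<Sum>c\<in>F. \<Sum>\<alpha>\<in>F. \<Sum>\<gamma>\<in>F. (norm (H c \<alpha> \<gamma>))\<^sup>2))
     = of_nat p * (\<Sum>c\<in>F. \<Sum>\<alpha>\<in>F. \<Sum>\<gamma>\<in>F. \<Sum>k\<in>F. \<Sum>k'\<in>F. ?Z k k' c \<alpha> \<gamma>)"
    by (simp only: of_real_mult of_real_sum Z of_real_of_nat_eq)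
  \<comment> \<open>Passing to sums over Cartesian products lets a single swap move both
    \<open>k\<close>, \<open>k'\<close> to the outside.\<close>
  also have "(\<Sum>c\<in>F. \<Sum>\<alpha>\<in>F. \<Sum>\<gamma>\<in>F. \<Sum>k\<in>F. \<Sum>k'\<in>F. ?Z k k' c \<alpha> \<gamma>)
     = (\<Sum>x\<in>F\<times>F\<times>F. \<Sum>y\<in>F\<times>F. ?Z (fst y) (snd y) (fst x) (fst (snd x)) (snd (snd x)))"
    by (simp only: sum.cartesian_product' fst_conv snd_conv)
  also have "\<dots> = (\<Sum>y\<in>F\<times>F. \<Sum>x\<in>F\<times>F\<times>F. ?Z (fst y) (snd y) (fst x) (fst (snd x)) (snd (snd x)))"
    by (rule sum.swap)
  also have "\<dots> = (\<Sum>k\<in>F. \<Sum>k'\<in>F. \<Sum>c\<in>F. \<Sum>\<alpha>\<in>F. \<Sum>\<gamma>\<in>F. ?Z k k' c \<alpha> \<gamma>)"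
    by (simp only: sum.cartesian_product' fst_conv snd_conv)
  also have "of_nat p * \<dots> = of_real (\<Sum>k\<in>F. \<Sum>k'\<in>F. \<Sum>t\<in>F. (real p * E k k' t) ^ 4)"
  proof -
    have "of_nat p * (\<Sum>k\<in>F. \<Sum>k'\<in>F. Y k k') = (\<Sum>k\<in>F. \<Sum>k'\<in>F. of_nat p * Y k k')"
      for Y :: "int \<Rightarrow> int \<Rightarrow> complex"
      by (simp only: sum_distrib_left)
    then show ?thesis by (simp only: inner of_real_sum)
  qed
  finally have "real p * (\<Sum>c\<in>F. \<Sum>\<alpha>\<in>F. \<Sum>\<gamma>\<in>F. (norm (H c \<alpha> \<gamma>))\<^sup>2)
     = (\<Sum>k\<in>F. \<Sum>k'\<in>F. \<Sum>t\<in>F. (real p * E k k' t) ^ 4)"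
    by (simp only: of_real_eq_iff)
  also have "\<dots> = real p * (real p ^ 3 * (\<Sum>k\<in>F. \<Sum>k'\<in>F. \<Sum>t\<in>F. (E k k' t) ^ 4))"
    by (simp add: power_mult_distrib sum_distrib_left eval_nat_numeral mult_ac)
  finally show ?thesis using p_gt_2 by simp
qed

section \<open>Assembling the bound\<close>

lemma gram_T_bound:
  "(\<Sum>i\<in>F. \<Sum>i'\<in>F. (\<Sum>j\<in>F. T i j * T i' j)\<^sup>2) \<le> 4484 * real p ^ 5"
proof -
  let ?p = "real p"
  define X where "X = (\<Sum>i\<in>F. \<Sum>i'\<in>F. (\<Sum>j\<in>F. T i j * T i' j)\<^sup>2)"
  \<comment> \<open>Bounding p - 1 below by p/2 doubles the constant 2242 to 4484.\<close>
  have p: "?p > 0" "?p / 2 \<le> ?p - 1" using p_gt_2 by auto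
  have "(norm (H 1 i i'))\<^sup>2 = ?p\<^sup>2 * (\<Sum>j\<in>F. T i j * T i' j)\<^sup>2" for i i'
    unfolding gram_T[symmetric] norm_mult norm_of_real by (simp add: power_mult_distrib)
  then have "(\<Sum>i\<in>F. \<Sum>i'\<in>F. (norm (H 1 i i'))\<^sup>2) = ?p\<^sup>2 * X"
    by (simp add: X_def sum_distrib_left)
  moreover have "X \<ge> 0" unfolding X_def by (intro sum_nonneg) auto
  ultimately have "?p / 2 * (?p\<^sup>2 * X) \<le> (?p - 1) * (\<Sum>i\<in>F. \<Sum>i'\<in>F. (norm (H 1 i i'))\<^sup>2)"
    using p by (simp only: ) (intro mult_right_mono, auto)
  also have "\<dots> \<le> ?p ^ 3 * (2242 * ?p ^ 5)"
    using sum_H_scale sum_E_fourth unfolding sum_H_square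
    by (meson mult_left_mono of_nat_0_le_iff order_trans zero_le_power)
  finally have "(?p ^ 3 / 2) * X \<le> (?p ^ 3 / 2) * (4484 * ?p ^ 5)"
    by (simp add: eval_nat_numeral mult_ac)
  then have "X \<le> 4484 * ?p ^ 5"
    by (rule mult_left_le_imp_le) (use p in simp)
  then show ?thesis by (simp only: X_def)
qed

lemma mat_opnorm_T: "mat_opnorm F (\<lambda>i j. real_of_int (T_entry p i j)) \<le> 9 * real p powr (5 / 4)"
proof (rule mat_opnorm_le_gram)
  \<comment> \<open>The constant 9 is the least integer whose fourth power, 6561, exceeds
    4484.\<close>
  have "(9 * real p powr (5 / 4)) ^ 4 = 6561 * real p ^ 5"
    using p_gt_2 by (simp add: power_mult_distrib powr_power)
  then show "(\<Sum>i\<in>F. \<Sum>i'\<in>F. (\<Sum>j\<in>F. real_of_int (T_entry p i j) * real_of_int (T_entry p i' j))\<^sup>2)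
      \<le> (9 * real p powr (5 / 4)) ^ 4"
    using order.trans[OF gram_T_bound, of "6561 * real p ^ 5"] by (simp add: T_entry_eq)
qed simp

end

theorem theorem4p21:
  shows "(\<lambda>p::nat. mat_opnorm {0..<int p} (\<lambda>i j. real_of_int (T_entry p i j)))
           \<in> O[inf at_top (principal {p. prime p \<and> [p = 1] (mod 4)})](\<lambda>p. real p powr (5 / 4))"
proof (rule bigoI[where c = 9])
  have bound: "norm (mat_opnorm {0..<int p} (\<lambda>i j. real_of_int (T_entry p i j))) \<le> 9 * norm (real p powr (5 / 4))"
    if "2 < p" "prime p" for p
  proof -
    interpret odd_prime p using that by unfold_locales
    show ?thesis using mat_opnorm_T by (simp add: mat_opnorm_nonneg)
  qed
  show "eventually (\<lambda>p. norm (mat_opnorm {0..<int p} (\<lambda>i j. real_of_int (T_entry p i j)))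
      \<le> 9 * norm (real p powr (5 / 4))) (inf at_top (principal {p. prime p \<and> [p = 1] (mod 4)}))"
    unfolding eventually_inf_principal
    \<comment> \<open>Eventually p > 2, so \<open>odd_prime\<close> applies.\<close>
    using eventually_gt_at_top[of "2::nat"] by eventually_elim (use bound in auto)
qed

end
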